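(* Fix an integer $m\ge1$ and indeterminates $x_0,\ldots,x_m,y,q$. Let $\boldsymbol\alpha=(\alpha_i)_{i\ge m}$ be given by $\alpha_{m+(m+1)j}=y+jx_0$ and $\alpha_{m+(m+1)j+i}=(j+1)x_i$ for $j\ge0$, $1\le i\le m$, i.e. $(\alpha_i)_{i\ge m}=(y,x_1,\ldots,x_m,y+x_0,2x_1,\ldots,2x_m,y+2x_0,3x_1,\ldots)$. Let $[S^{(m)}_{n,k}(\boldsymbol\alpha)]_{n,k}$ be the $m$-Stieltjes--Rogers triangle, $S_n(\boldsymbol\alpha;q)=\sum_kS^{(m)}_{n,k}(\boldsymbol\alpha)q^k$ its row-generating polynomials, and $S^*_n(\boldsymbol\alpha;q)=q^nS_n(\boldsymbol\alpha;1/q)$. Then: (i) $(S_n(\boldsymbol\alpha;q))_{n\ge0}$ and $(S^*_n(\boldsymbol\alpha;q))_{n\ge0}$ are $3$-$(x_0,\ldots,x_m,y,q)$-log-convex; (ii) for all real $x_0,\ldots,x_m,y\ge0$, the convolution $z_n=\sum_{k=0}^nS^{(m)}_{n,k}(\boldsymbol\alpha)s_kt_{n-k}$ preserves the Stieltjes moment property: whenever $(s_n)_{n\ge0}$ and $(t_n)_{n\ge0}$ are Stieltjes moment sequences of real numbers, so is $(z_n)_{n\ge0}$.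
   Context: $S^{(m)}_{n,k}(\boldsymbol\alpha)$ is the generating polynomial of partial $m$-Dyck paths (paths in $\mathbb Z\times\mathbb N$ starting on the horizontal axis with steps $(1,1)$ and $(1,-m)$) from $(0,0)$ to $((m+1)n,(m+1)k)$, each rise having weight $1$ and each $(1,-m)$ step starting at height $i$ having weight $\alpha_i$. For a sequence $(a_n)$ of polynomials in indeterminates $\mathbf z$, define $\mathcal L[a_i]=a_{i-1}a_{i+1}-a_i^2$ ($i\ge1$), $\mathcal L^k=\mathcal L(\mathcal L^{k-1})$; the sequence is $3$-$\mathbf z$-log-convex if $\mathcal L^k[a_i]$ has nonnegative coefficients for all $k\le3$ and all admissible $i$. A real sequence $(a_n)_{n\ge0}$ is a Stieltjes moment sequence if $a_n=\int_0^\infty x^n\,d\mu(x)$ for a nonnegative measure $\mu$ on $[0,\infty)$ (equivalently its Hankel matrix $[a_{i+j}]$ is totally positive). *)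

theory Defs
  imports "HOL-Analysis.Analysis" "HOL-Library.Poly_Mapping"
begin

section \<open>Partial \<open>m\<close>-Dyck paths and the \<open>m\<close>-Stieltjes--Rogers triangle\<close>

type_synonym point = "int \<times> nat"

definition mdyck_step :: "nat \<Rightarrow> point \<Rightarrow> point \<Rightarrow> bool" where
  "mdyck_step m p p' \<longleftrightarrow>
     fst p' = fst p + 1 \<and> (snd p' = snd p + 1 \<or> snd p = snd p' + m)"

text \<open>A path is the list of its vertices; that it never goes below the horizontal axis is
  expressed by ordinates being natural numbers.\<close>

definition partial_mdyck_paths :: "nat \<Rightarrow> point \<Rightarrow> point \<Rightarrow> point list set" where
  "partial_mdyck_paths m P Q =
     {ps. ps \<noteq> [] \<and> hd ps = P \<and> last ps = Q \<and> successively (mdyck_step m) ps}"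

definition step_weight :: "(nat \<Rightarrow> 'a::comm_semiring_1) \<Rightarrow> point \<Rightarrow> point \<Rightarrow> 'a" where
  "step_weight \<alpha> p p' = (if snd p' = snd p + 1 then 1 else \<alpha> (snd p))"

definition path_weight :: "(nat \<Rightarrow> 'a::comm_semiring_1) \<Rightarrow> point list \<Rightarrow> 'a" where
  "path_weight \<alpha> ps = prod_list (map2 (step_weight \<alpha>) ps (tl ps))"

definition SR_triangle :: "nat \<Rightarrow> (nat \<Rightarrow> 'a::comm_semiring_1) \<Rightarrow> nat \<Rightarrow> nat \<Rightarrow> 'a" where
  "SR_triangle m \<alpha> n k =
     (\<Sum>ps \<in> partial_mdyck_paths m (0, 0) (int ((m + 1) * n), (m + 1) * k). path_weight \<alpha> ps)"

lemma mdyck_path_coords: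
  assumes "successively (mdyck_step m) ps" "i < length ps"
  shows "fst (ps ! i) = fst (hd ps) + int i" "snd (ps ! i) \<le> snd (hd ps) + i"
proof -
  have "fst (ps ! i) = fst (hd ps) + int i \<and> snd (ps ! i) \<le> snd (hd ps) + i"
    using assms
  proof (induction ps arbitrary: i)
    case (Cons p ps)
    show ?case
    proof (cases i)
      case (Suc j)
      with Cons.prems have j: "j < length ps" and ne: "ps \<noteq> []" by auto
      from Cons.prems ne have "mdyck_step m p (hd ps)" "successively (mdyck_step m) ps"
        by (auto simp: successively_Cons)
      with Cons.IH[OF _ j] Suc show ?thesis by (auto simp: mdyck_step_def)
    qed simp
  qed simp
  then show "fst (ps ! i) = fst (hd ps) + int i" "snd (ps ! i) \<le> snd (hd ps) + i" by auto
qed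

lemma mdyck_path_length:
  assumes "ps \<in> partial_mdyck_paths m P Q"
  shows "fst Q = fst P + int (length ps - 1)" "snd Q \<le> snd P + (length ps - 1)"
proof -
  from assms have *: "successively (mdyck_step m) ps" "length ps - 1 < length ps"
    and PQ: "hd ps = P" "ps ! (length ps - 1) = Q"
    by (auto simp: partial_mdyck_paths_def last_conv_nth)
  from mdyck_path_coords[OF *]
  show "fst Q = fst P + int (length ps - 1)" "snd Q \<le> snd P + (length ps - 1)"
    by (simp_all only: PQ)
qed

lemma finite_partial_mdyck_paths: "finite (partial_mdyck_paths m P Q)"
proof (rule finite_subset)
  let ?N = "nat (fst Q - fst P)"
  let ?A = "{fst P..fst P + int ?N} \<times> {..snd P + ?N}"
  show "partial_mdyck_paths m P Q \<subseteq> {ps. set ps \<subseteq> ?A \<and> length ps = ?N + 1}"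
  proof
    fix ps assume ps: "ps \<in> partial_mdyck_paths m P Q"
    then have ne: "ps \<noteq> []" and hd: "hd ps = P" and succ: "successively (mdyck_step m) ps"
      by (auto simp: partial_mdyck_paths_def)
    from mdyck_path_length(1)[OF ps] ne have len: "length ps = ?N + 1"
      by (cases ps) auto
    have "p \<in> ?A" if "p \<in> set ps" for p
    proof -
      from that obtain i where i: "i < length ps" "p = ps ! i" by (auto simp: in_set_conv_nth)
      with mdyck_path_coords[OF succ i(1)] len hd show ?thesis
        by (auto simp: mem_Times_iff)
    qed
    with len show "ps \<in> {ps. set ps \<subseteq> ?A \<and> length ps = ?N + 1}" by blast
  qed
  show "finite {ps. set ps \<subseteq> ?A \<and> length ps = ?N + 1}"
    by (rule finite_lists_length_eq) simp
qed

lemma SR_triangle_eq_0: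
  assumes "n < k"
  shows "SR_triangle m \<alpha> n k = 0"
proof -
  have "partial_mdyck_paths m (0, 0) (int ((m + 1) * n), (m + 1) * k) = {}"
  proof (rule ccontr)
    assume "\<not> ?thesis"
    then obtain ps where ps: "ps \<in> partial_mdyck_paths m (0, 0) (int ((m + 1) * n), (m + 1) * k)"
      by blast
    from mdyck_path_length[OF ps] have "(m + 1) * k \<le> (m + 1) * n"
      by (simp del: of_nat_mult of_nat_add)
    then have "k \<le> n" by (simp only: mult_le_cancel1)
    with assms show False by simp
  qed
  then show ?thesis unfolding SR_triangle_def by (simp only: sum.empty)
qed

text \<open>By the preceding lemma, summing over \<open>k \<le> n\<close> is summing over all \<open>k\<close>.\<close>

definition SR_row_poly :: "nat \<Rightarrow> (nat \<Rightarrow> 'a::comm_semiring_1) \<Rightarrow> nat \<Rightarrow> 'a \<Rightarrow> 'a" where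
  "SR_row_poly m \<alpha> n q = (\<Sum>k\<le>n. SR_triangle m \<alpha> n k * q ^ k)"

text \<open>The reciprocal polynomial \<open>q\<^sup>n S\<^sub>n(1/q)\<close>, written without inverting \<open>q\<close> so that it makes
  sense for an indeterminate.\<close>

definition SR_rev_row_poly :: "nat \<Rightarrow> (nat \<Rightarrow> 'a::comm_semiring_1) \<Rightarrow> nat \<Rightarrow> 'a \<Rightarrow> 'a" where
  "SR_rev_row_poly m \<alpha> n q = (\<Sum>k\<le>n. SR_triangle m \<alpha> n k * q ^ (n - k))"

lemma SR_rev_row_poly_eq:
  fixes q :: "'a::field"
  assumes "q \<noteq> 0"
  shows "SR_rev_row_poly m \<alpha> n q = q ^ n * SR_row_poly m \<alpha> n (1 / q)"
  unfolding SR_rev_row_poly_def SR_row_poly_def sum_distrib_left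
  by (rule sum.cong) (use assms in \<open>auto simp: power_diff power_one_over field_simps\<close>)

section \<open>The weights\<close>

text \<open>Only the values at \<open>i \<ge> m\<close> matter, since no step \<open>(1, -m)\<close> starts below height \<open>m\<close>.\<close>

definition SR_alpha :: "nat \<Rightarrow> (nat \<Rightarrow> 'a::comm_semiring_1) \<Rightarrow> 'a \<Rightarrow> nat \<Rightarrow> 'a" where
  "SR_alpha m x y i =
     (let j = (i - m) div (m + 1); r = (i - m) mod (m + 1)
      in if r = 0 then y + of_nat j * x 0 else of_nat (j + 1) * x r)"

lemma SR_alpha_0: "SR_alpha m x y (m + (m + 1) * j) = y + of_nat j * x 0"
  unfolding SR_alpha_def Let_def by (simp del: mult_Suc)

lemma SR_alpha_pos:
  assumes "1 \<le> i" "i \<le> m"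
  shows "SR_alpha m x y (m + (m + 1) * j + i) = of_nat (j + 1) * x i"
proof -
  have "((m + 1) * j + i) div (m + 1) = j" "((m + 1) * j + i) mod (m + 1) = i"
    using assms by (simp_all only: div_mult_self4 mod_mult_self4) (simp_all del: mult_Suc)
  moreover have "m + (m + 1) * j + i - m = (m + 1) * j + i" by simp
  ultimately show ?thesis using assms unfolding SR_alpha_def Let_def by (simp only:) auto
qed

section \<open>Multivariate polynomials and higher-order log-convexity\<close>

type_synonym 'v mpoly = "('v \<Rightarrow>\<^sub>0 nat) \<Rightarrow>\<^sub>0 real"

definition indet :: "'v \<Rightarrow> 'v mpoly" where
  "indet v = Poly_Mapping.single (Poly_Mapping.single v 1) 1"

text \<open>The indeterminates \<open>x\<^sub>i\<close> with \<open>i > m\<close> are available but do not occur in the polynomials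
  considered.\<close>

datatype var = X nat | Y | Q

definition nonneg_coeffs :: "'v mpoly \<Rightarrow> bool" where
  "nonneg_coeffs p \<longleftrightarrow> (\<forall>t. 0 \<le> Poly_Mapping.lookup p t)"

definition log_op :: "(nat \<Rightarrow> 'a::comm_ring_1) \<Rightarrow> nat \<Rightarrow> 'a" where
  "log_op a i = a (i - 1) * a (i + 1) - (a i)\<^sup>2"

text \<open>Since \<open>log_op a i\<close> is meant for \<open>i \<ge> 1\<close> only, its \<open>k\<close>-th iterate is meant for \<open>i \<ge> k\<close> only,
  and for such \<open>i\<close> no truncated subtraction is involved.\<close>

definition mpoly_log_convex :: "nat \<Rightarrow> (nat \<Rightarrow> 'v mpoly) \<Rightarrow> bool" where
  "mpoly_log_convex r a \<longleftrightarrow> (\<forall>k\<le>r. \<forall>i\<ge>k. nonneg_coeffs ((log_op ^^ k) a i))"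

section \<open>Stieltjes moment sequences\<close>

definition stieltjes_moment_seq :: "(nat \<Rightarrow> real) \<Rightarrow> bool" where
  "stieltjes_moment_seq a \<longleftrightarrow>
     (\<exists>\<mu> :: real measure. sets \<mu> = sets (restrict_space borel {0..}) \<and>
        (\<forall>n. has_bochner_integral \<mu> (\<lambda>x. x ^ n) (a n)))"

end

theory Submission
  imports Defs "Jordan_Normal_Form.Determinant"
begin

text \<open>
  Grouping the steps of a path in blocks of \<open>m + 1\<close> shows that the triangle has the production matrix
  \<open>P = L\<^sub>1 \<cdots> L\<^sub>m U\<close>, where \<open>L\<^sub>i = 1 + x\<^sub>i D\<close> and \<open>U = (1 + x\<^sub>0 D) E + y\<close> with
  \<open>(D \<psi>) j = j \<psi> (j - 1)\<close> and \<open>E\<close> the shift. Conjugation by the binomial matrix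
  \<open>exp (u D)\<close> fixes the \<open>L\<^sub>i\<close> and turns \<open>E\<close> into \<open>E + u\<close>; hence
  \<open>\<Sum>\<^sub>k S\<^sub>n\<^sub>k u\<^sup>k\<close> is the \<open>(0, 0)\<close> entry of the \<open>n\<close>-th power of
  \<open>L\<^sub>1 \<cdots> L\<^sub>m ((1 + x\<^sub>0 D) (E + u) + y)\<close>. Scaling all weights by \<open>v\<close> inserts the factor
  \<open>v\<^sup>n\<^sup>-\<^sup>k\<close>, which covers the reversed polynomials too. The whole Hankel matrix of such a
  sequence is a product of matrices with nonnegative entries in which the supports of consecutive rows
  are intervals overlapping in at most one column.

  (i) Such factors preserve nonnegativity of minors, coefficientwise. By the Desnanot--Jacobi identity
  the first three iterates of the log-operator are polynomials with nonnegative coefficients in Hankel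
  minors of order at most 4.

  (ii) Over the reals such factors diminish sign variation, which makes the symmetric Hankel matrices
  positive semidefinite, also after shifting the sequence. Positive semidefiniteness passes to the
  convolution by integrating over \<open>u\<close> and \<open>v\<close>, and the Stieltjes moment problem is
  solved by M. Riesz extension of the moment functional to indicators of half lines.
\<close>

section \<open>Staircase matrices\<close>

text \<open>Infinite matrices are represented as operators on sequences. In a staircase the last column
  available to a row is the first one available to the next row.\<close>

definition stair :: "(nat \<Rightarrow> nat) \<Rightarrow> (nat \<Rightarrow> nat \<Rightarrow> 'a) \<Rightarrow> (nat \<Rightarrow> 'a) \<Rightarrow> nat \<Rightarrow> 'a::comm_ring_1" where
  "stair f w \<psi> i = (\<Sum>j = f i..f (Suc i). w i j * \<psi> j)"

text \<open>The block matrix \<open>diag(1, T)\<close>.\<close>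

definition shift_op :: "((nat \<Rightarrow> 'a) \<Rightarrow> nat \<Rightarrow> 'a) \<Rightarrow> (nat \<Rightarrow> 'a) \<Rightarrow> nat \<Rightarrow> 'a" where
  "shift_op T \<psi> i = (case i of 0 \<Rightarrow> \<psi> 0 | Suc k \<Rightarrow> T (\<lambda>j. \<psi> (Suc j)) k)"

lemma shift_op_stair:
  "shift_op (stair f w :: (nat \<Rightarrow> 'a::comm_ring_1) \<Rightarrow> nat \<Rightarrow> 'a) =
     stair (\<lambda>i. case i of 0 \<Rightarrow> 0 | Suc k \<Rightarrow> Suc (f k))
       (\<lambda>i j. case i of 0 \<Rightarrow> (if j = 0 then 1 else 0) | Suc k \<Rightarrow> w k (j - 1))"
proof (intro ext)
  fix \<psi> :: "nat \<Rightarrow> 'a" and i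
  show "shift_op (stair f w) \<psi> i = stair (\<lambda>i. case i of 0 \<Rightarrow> 0 | Suc k \<Rightarrow> Suc (f k))
       (\<lambda>i j. case i of 0 \<Rightarrow> (if j = 0 then 1 else 0) | Suc k \<Rightarrow> w k (j - 1)) \<psi> i"
  proof (cases i)
    case 0
    have "(\<Sum>j = 0..Suc (f 0). (if j = 0 then 1 else 0) * \<psi> j) = (\<Sum>j\<in>{0}. \<psi> j)"
      by (rule sum.mono_neutral_cong_right) auto
    with 0 show ?thesis by (simp add: shift_op_def stair_def)
  next
    case (Suc k)
    then show ?thesis
      unfolding shift_op_def stair_def by (simp add: sum.shift_bounds_cl_Suc_ivl del: sum.cl_ivl_Suc)
  qed
qed

section \<open>Minors of staircase products with entries in a cone\<close>

locale pos_cone =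
  fixes C :: "'a::comm_ring_1 set"
  assumes zero_in [simp, intro]: "0 \<in> C"
    and one_in [simp, intro]: "1 \<in> C"
    and add_in [simp, intro]: "\<And>a b. a \<in> C \<Longrightarrow> b \<in> C \<Longrightarrow> a + b \<in> C"
    and mult_in [simp, intro]: "\<And>a b. a \<in> C \<Longrightarrow> b \<in> C \<Longrightarrow> a * b \<in> C"
begin

lemma sum_in: "(\<And>i. i \<in> S \<Longrightarrow> g i \<in> C) \<Longrightarrow> sum g S \<in> C"
  by (induction S rule: infinite_finite_induct) auto

lemma prod_in: "(\<And>i. i \<in> S \<Longrightarrow> g i \<in> C) \<Longrightarrow> prod g S \<in> C"
  by (induction S rule: infinite_finite_induct) auto

lemma of_nat_in [simp, intro]: "of_nat n \<in> C"
  by (induction n) auto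

text \<open>Finite products of staircases with entries in \<open>C\<close>. The cone will be either
  the polynomials with nonnegative coefficients or the nonnegative reals.\<close>

inductive net :: "((nat \<Rightarrow> 'a) \<Rightarrow> nat \<Rightarrow> 'a) \<Rightarrow> bool" where
  net_id: "net id"
| net_stair_comp: "mono f \<Longrightarrow> (\<And>i j. w i j \<in> C) \<Longrightarrow> net T \<Longrightarrow> net (stair f w \<circ> T)"

lemma net_stair: "mono f \<Longrightarrow> (\<And>i j. w i j \<in> C) \<Longrightarrow> net (stair f w)"
  using net_stair_comp[OF _ _ net_id] by simp

lemma net_comp: "net S \<Longrightarrow> net T \<Longrightarrow> net (S \<circ> T)"
  by (induction rule: net.induct) (auto simp: comp_assoc intro: net_stair_comp)

lemma net_shift_op: "net T \<Longrightarrow> net (shift_op T)"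
proof (induction rule: net.induct)
  case net_id
  have "shift_op id = (id :: (nat \<Rightarrow> 'a) \<Rightarrow> nat \<Rightarrow> 'a)"
    by (auto simp: shift_op_def fun_eq_iff split: nat.split)
  then show ?case using net.net_id by (simp only:)
next
  case (net_stair_comp f w T)
  have eq: "shift_op (stair f w \<circ> T) = shift_op (stair f w) \<circ> shift_op T"
    by (auto simp: shift_op_def fun_eq_iff split: nat.split)
  have "net (shift_op (stair f w))"
    unfolding shift_op_stair
  proof (rule net_stair)
    show "mono (case_nat 0 (\<lambda>k. Suc (f k)))"
      using net_stair_comp.hyps(1) by (auto simp: mono_def split: nat.split)
  qed (use net_stair_comp.hyps(2) in \<open>auto split: nat.split\<close>)
  then show ?case unfolding eq using net_stair_comp.IH by (rule net_comp)
qed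

lemma net_linear:
  assumes "net T"
  shows "T (\<lambda>j. \<Sum>l\<in>S. c l * \<psi> l j) = (\<lambda>i. \<Sum>l\<in>S. c l * T (\<psi> l) i)"
  using assms
proof (induction rule: net.induct)
  case (net_stair_comp f w T)
  then show ?case
    by (auto simp: fun_eq_iff stair_def sum_distrib_left mult.left_commute intro: sum.swap)
qed simp

text \<open>The sequences \<open>v 0, ..., v (k - 1)\<close> are the columns. Arbitrary increasing
  rows but only these columns are considered, which is enough for Hankel determinants, since moving
  the first row shifts the sequence.\<close>

definition tp_family :: "nat \<Rightarrow> (nat \<Rightarrow> nat \<Rightarrow> 'a) \<Rightarrow> bool" where
  "tp_family k v \<longleftrightarrow>
     (\<forall>r. strict_mono_on {..<k} r \<longrightarrow> Determinant.det (mat k k (\<lambda>(i, j). v j (r i))) \<in> C)"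

text \<open>Multilinearity in the rows: row \<open>r i\<close> of the product is a combination of
  the rows in its window, and \<open>g\<close> records which of them is picked.\<close>

lemma det_stair_rows:
  "Determinant.det (mat k k (\<lambda>(i, j). stair f w (v j) (r i))) =
     (\<Sum>g \<in> (\<Pi>\<^sub>E i\<in>{0..<k}. {f (r i)..f (Suc (r i))}).
        (\<Prod>i=0..<k. w (r i) (g i)) * Determinant.det (mat k k (\<lambda>(i, j). v j (g i))))"
    (is "_ = (\<Sum>g \<in> ?G. _)")
proof -
  let ?P = "{p. p permutes {0..<k}}"
  have "Determinant.det (mat k k (\<lambda>(i, j). stair f w (v j) (r i))) =
      (\<Sum>p\<in>?P. signof p * (\<Prod>i = 0..<k. stair f w (v (p i)) (r i)))"
    unfolding Determinant.det_def by (auto intro!: sum.cong prod.cong simp: permutes_in_image)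
  also have "\<dots> = (\<Sum>p\<in>?P. \<Sum>g\<in>?G. (\<Prod>i=0..<k. w (r i) (g i)) * (signof p * (\<Prod>i=0..<k. v (p i) (g i))))"
    unfolding stair_def
    by (subst prod_sum_PiE) (auto simp: prod.distrib sum_distrib_left ac_simps)
  also have "\<dots> = (\<Sum>g\<in>?G. (\<Prod>i=0..<k. w (r i) (g i)) * (\<Sum>p\<in>?P. signof p * (\<Prod>i=0..<k. v (p i) (g i))))"
    by (subst sum.swap) (simp add: sum_distrib_left)
  also have "\<dots> = (\<Sum>g\<in>?G. (\<Prod>i=0..<k. w (r i) (g i)) * Determinant.det (mat k k (\<lambda>(i, j). v j (g i))))"
    unfolding Determinant.det_def
    by (intro sum.cong arg_cong2[where f = "(*)"] refl) (auto intro!: sum.cong prod.cong simp: permutes_in_image)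
  finally show ?thesis .
qed

text \<open>Windows of later rows start no earlier than those of previous rows end, so every pick
  \<open>g\<close> is weakly increasing. A tie produces two equal rows and a zero determinant;
  without ties \<open>g\<close> is strictly increasing and the hypothesis on \<open>v\<close>
  applies.\<close>

lemma tp_family_stair:
  assumes "mono f" "\<And>i j. w i j \<in> C" "tp_family k v"
  shows "tp_family k (\<lambda>j. stair f w (v j))"
  unfolding tp_family_def
proof (intro allI impI)
  fix r :: "nat \<Rightarrow> nat" assume r: "strict_mono_on {..<k} r"
  show "Determinant.det (mat k k (\<lambda>(i, j). stair f w (v j) (r i))) \<in> C"
    unfolding det_stair_rows
  proof (intro sum_in mult_in prod_in assms(2))
    fix g assume g: "g \<in> (\<Pi>\<^sub>E i\<in>{0..<k}. {f (r i)..f (Suc (r i))})"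
    have le: "g a \<le> g b" if "a < b" "b < k" for a b
    proof -
      have "g a \<le> f (Suc (r a))" using g that by (auto simp: PiE_iff)
      also have "\<dots> \<le> f (r b)"
        using strict_mono_onD[OF r, of a b] that by (intro monoD[OF assms(1)]) auto
      also have "\<dots> \<le> g b" using g that by (auto simp: PiE_iff)
      finally show ?thesis .
    qed
    show "Determinant.det (mat k k (\<lambda>(i, j). v j (g i))) \<in> C"
    proof (cases "inj_on g {..<k}")
      case True
      then have "strict_mono_on {..<k} g"
        by (auto simp: strict_mono_on_def inj_on_def order.strict_iff_order le)
      then show ?thesis using assms(3) by (auto simp: tp_family_def)
    next
      case False
      then obtain a b where ab: "a < k" "b < k" "a \<noteq> b" "g a = g b"
        by (auto simp: inj_on_def)
      have "Determinant.det (mat k k (\<lambda>(i, j). v j (g i))) = 0"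
        by (rule det_identical_rows[of _ k a b]) (use ab in auto)
      then show ?thesis by simp
    qed
  qed
qed

lemma tp_family_net: "net T \<Longrightarrow> tp_family k v \<Longrightarrow> tp_family k (\<lambda>j. T (v j))"
  by (induction rule: net.induct) (auto intro: tp_family_stair)

text \<open>Increasing rows satisfy \<open>i \<le> r i\<close>, so the minor is upper triangular
  with diagonal entries 0 or 1.\<close>

lemma tp_family_unit: "tp_family k (\<lambda>j i. if i = j then 1 else 0)"
  unfolding tp_family_def
proof (intro allI impI)
  fix r :: "nat \<Rightarrow> nat" assume r: "strict_mono_on {..<k} r"
  have ge: "i \<le> r i" if "i < k" for i
    using that
  proof (induction i)
    case (Suc i)
    with strict_mono_onD[OF r, of i "Suc i"] show ?case by auto
  qed simp
  let ?A = "mat k k (\<lambda>(i, j). if r i = j then 1 else 0) :: 'a mat"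
  have "Determinant.det ?A = prod_list (diag_mat ?A)"
    by (rule det_upper_triangular[of _ k]) (use ge in \<open>fastforce simp: upper_triangular_def\<close>)+
  also have "\<dots> = (\<Prod>i=0..<k. if r i = i then 1 else 0)"
    unfolding prod_list_diag_prod by simp
  also have "\<dots> \<in> C" by (intro prod_in) auto
  finally show "Determinant.det ?A \<in> C" .
qed

end

section \<open>Sign variation and positive semidefiniteness\<close>

text \<open>At least \<open>k - 1\<close> sign changes, with the sign at the first chosen position
  given by \<open>s\<close>. Recording that sign is what later allows a pattern of maximal length to
  be prolonged.\<close>

definition alternates :: "real \<Rightarrow> nat \<Rightarrow> (nat \<Rightarrow> real) \<Rightarrow> bool" where
  "alternates s k \<psi> \<longleftrightarrow>
     (\<exists>i. (\<forall>l. Suc l < k \<longrightarrow> i l < i (Suc l)) \<and> (\<forall>l<k. 0 < s * (-1) ^ l * \<psi> (i l)))"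

text \<open>A nonnegative combination of the required sign needs a term of that sign in its window.
  Consecutive choices are weakly ordered because the windows are, and distinct because their signs
  differ.\<close>

lemma alternates_stair:
  assumes "mono f" and w: "\<And>i j. 0 \<le> w i j" and "alternates s k (stair f w \<psi>)"
  shows "alternates s k \<psi>"
proof -
  from assms(3) obtain i where i: "\<And>l. Suc l < k \<Longrightarrow> i l < i (Suc l)"
    and pos: "\<And>l. l < k \<Longrightarrow> 0 < s * (-1) ^ l * stair f w \<psi> (i l)"
    unfolding alternates_def by blast
  have "\<forall>l. \<exists>j. l < k \<longrightarrow> f (i l) \<le> j \<and> j \<le> f (Suc (i l)) \<and> 0 < s * (-1) ^ l * \<psi> j"
  proof (intro allI, cases)
    fix l assume l: "l < k"
    have "0 < (\<Sum>j = f (i l)..f (Suc (i l)). w (i l) j * (s * (-1) ^ l * \<psi> j))"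
      using pos[OF l] unfolding stair_def by (simp add: sum_distrib_left mult_ac)
    then obtain j where "j \<in> {f (i l)..f (Suc (i l))}" "0 < w (i l) j * (s * (-1) ^ l * \<psi> j)"
      using sum_nonpos by (metis (no_types, lifting) not_less)
    with w[of "i l" j] show "\<exists>j. l < k \<longrightarrow> f (i l) \<le> j \<and> j \<le> f (Suc (i l)) \<and> 0 < s * (-1) ^ l * \<psi> j"
      by (intro exI[of _ j]) (auto simp: zero_less_mult_iff)
  qed auto
  then obtain j where j: "\<And>l. l < k \<Longrightarrow> f (i l) \<le> j l \<and> j l \<le> f (Suc (i l)) \<and> 0 < s * (-1) ^ l * \<psi> (j l)"
    by metis
  have "j l < j (Suc l)" if l: "Suc l < k" for l
  proof -
    have "j l \<le> f (Suc (i l))" using j l by simp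
    also have "\<dots> \<le> f (i (Suc l))" using i[OF l] by (intro monoD[OF assms(1)]) simp
    also have "\<dots> \<le> j (Suc l)" using j l by simp
    finally have "j l \<le> j (Suc l)" .
    moreover have "j l \<noteq> j (Suc l)"
    proof
      assume "j l = j (Suc l)"
      with j[of l] j[OF l] l show False by simp
    qed
    ultimately show ?thesis by simp
  qed
  with j show ?thesis unfolding alternates_def by blast
qed

interpretation real_cone: pos_cone "{0::real..}"
  by unfold_locales auto

lemma alternates_net: "real_cone.net T \<Longrightarrow> alternates s k (T \<psi>) \<Longrightarrow> alternates s k \<psi>"
  by (induction arbitrary: \<psi> rule: real_cone.net.induct) (auto dest: alternates_stair[rotated 2])

lemma alternates_length:
  assumes "alternates s k c" "\<And>n. N \<le> n \<Longrightarrow> c n = 0"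
  shows "k \<le> N"
proof -
  from assms(1) obtain i where i: "\<And>l. Suc l < k \<Longrightarrow> i l < i (Suc l)"
    and pos: "\<And>l. l < k \<Longrightarrow> 0 < s * (-1) ^ l * c (i l)"
    unfolding alternates_def by blast
  have ge: "l \<le> i l" if "l < k" for l
    using that
  proof (induction l)
    case (Suc l)
    with i[of l] show ?case by simp
  qed simp
  show ?thesis
  proof (cases k)
    case (Suc l)
    with ge[of l] pos[of l] assms(2)[of "i l"] show ?thesis by (cases "N \<le> i l") auto
  qed simp
qed

text \<open>If all products were negative, then \<open>c\<close> would contain its longest alternating pattern with
  both signs, hence a longer one.\<close>

lemma not_alternates_negated:
  assumes vd: "\<And>s k. alternates s k d \<Longrightarrow> alternates s k c"
    and c0: "\<And>n. N \<le> n \<Longrightarrow> c n = 0" and ne: "c n0 \<noteq> 0"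
  shows "\<exists>n. c n \<noteq> 0 \<and> 0 \<le> c n * d n"
proof (rule ccontr)
  assume "\<not> ?thesis"
  then have neg: "\<And>n. c n \<noteq> 0 \<Longrightarrow> c n * d n < 0" by force
  define K where "K = {k. \<exists>s. (s = 1 \<or> s = -1) \<and> alternates s k c}"
  have fin: "finite K"
    using alternates_length[OF _ c0] by (intro finite_subset[of K "{..N}"]) (auto simp: K_def)
  have one: "1 \<in> K"
  proof (cases "c n0 > 0")
    case True
    then have "alternates 1 1 c" unfolding alternates_def by (intro exI[of _ "\<lambda>_. n0"]) simp
    then show ?thesis unfolding K_def by blast
  next
    case False
    with ne have "alternates (-1) 1 c" unfolding alternates_def by (intro exI[of _ "\<lambda>_. n0"]) simp
    then show ?thesis unfolding K_def by blast
  qed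
  define k where "k = Max K"
  have kK: "k \<in> K" and k1: "1 \<le> k" and kmax: "Suc k \<notin> K"
    using Max_in[OF fin] Max_ge[OF fin, of "Suc k"] Max_ge[OF fin one] one by (auto simp: k_def)
  then obtain s where s: "s = 1 \<or> s = -1" and "alternates s k c" unfolding K_def by blast
  then obtain i where i: "\<And>l. Suc l < k \<Longrightarrow> i l < i (Suc l)"
    and ipos: "\<And>l. l < k \<Longrightarrow> 0 < s * (-1) ^ l * c (i l)"
    unfolding alternates_def by blast
  have "0 < - s * (-1) ^ l * d (i l)" if "l < k" for l
    using ipos[OF that] neg[of "i l"] s by (cases "even l") (auto simp: mult_less_0_iff)
  with i have "alternates (- s) k d" unfolding alternates_def by blast
  from vd[OF this] obtain j where j: "\<And>l. Suc l < k \<Longrightarrow> j l < j (Suc l)"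
    and jpos: "\<And>l. l < k \<Longrightarrow> 0 < - s * (-1) ^ l * c (j l)"
    unfolding alternates_def by blast
  \<comment> \<open>The patterns \<open>i\<close> and \<open>j\<close> have maximal length and
    opposite first signs. Whichever starts first lends its first position to the other, giving
    length \<open>k + 1\<close>.\<close>
  have ext: "Suc k \<in> K" if "a 0 < b 0" "\<And>l. Suc l < k \<Longrightarrow> b l < b (Suc l)" "t = 1 \<or> t = -1"
      "0 < t * c (a 0)" "\<And>l. l < k \<Longrightarrow> 0 < - t * (-1) ^ l * c (b l)" for a b :: "nat \<Rightarrow> nat" and t
  proof -
    have "alternates t (Suc k) c"
      unfolding alternates_def
      by (rule exI[of _ "\<lambda>l. case l of 0 \<Rightarrow> a 0 | Suc l \<Rightarrow> b l"])
         (use that in \<open>auto split: nat.split simp: less_Suc_eq_0_disj\<close>)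
    with that(3) show ?thesis unfolding K_def by blast
  qed
  have "i 0 \<noteq> j 0" using ipos[of 0] jpos[of 0] k1 by auto
  then show False
    using ext[of i j s] ext[of j i "- s"] kmax i j ipos jpos ipos[of 0] jpos[of 0] k1 s
    by (cases "i 0 < j 0") auto
qed

text \<open>By Fiedler and Ptak, the second hypothesis says that all principal minors are nonnegative; it
  passes to the Schur complement of a positive diagonal entry after perturbing the eliminated coordinate.\<close>

lemma symmetric_P0_psd:
  fixes h :: "nat \<Rightarrow> nat \<Rightarrow> real"
  assumes "\<And>i j. h i j = h j i"
    and "\<And>c n. n < N \<Longrightarrow> c n \<noteq> 0 \<Longrightarrow> \<exists>n<N. c n \<noteq> 0 \<and> 0 \<le> c n * (\<Sum>j<N. h n j * c j)"
  shows "0 \<le> (\<Sum>i<N. \<Sum>j<N. c i * c j * h i j)"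
  using assms
proof (induction N arbitrary: h c)
  case (Suc N)
  note sym = Suc.prems(1) and P0 = Suc.prems(2)
  have form: "(\<Sum>i<Suc N. \<Sum>j<Suc N. c i * c j * g i j) =
      (\<Sum>i<N. \<Sum>j<N. c i * c j * g i j) + 2 * c N * (\<Sum>j<N. g N j * c j) + (c N)\<^sup>2 * g N N"
    if "\<And>i j. g i j = g j i" for g :: "nat \<Rightarrow> nat \<Rightarrow> real" and c
  proof -
    have "(\<Sum>i<N. c i * c N * g i N) = c N * (\<Sum>j<N. g N j * c j)"
      unfolding sum_distrib_left by (rule sum.cong) (auto simp: that[of _ N])
    moreover have "(\<Sum>j<N. c N * c j * g N j) = c N * (\<Sum>j<N. g N j * c j)"
      unfolding sum_distrib_left by (rule sum.cong) auto
    ultimately show ?thesis by (simp add: sum.distrib power2_eq_square)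
  qed
  have diag: "0 \<le> h k k" if k: "k < Suc N" for k
  proof -
    have *: "(\<Sum>j<Suc N. h k j * (if j = k then 1 else 0)) = h k k"
      using k by (simp add: if_distrib[of "\<lambda>z. h k _ * z"] cong: if_cong del: sum.lessThan_Suc)
    obtain n where "n < Suc N" "(if n = k then 1 else 0) \<noteq> (0::real)"
       "0 \<le> (if n = k then 1 else 0) * (\<Sum>j<Suc N. h n j * (if j = k then 1 else 0))"
      using P0[of k "\<lambda>j. if j = k then 1 else 0"] k by auto
    then have "n = k" "0 \<le> (\<Sum>j<Suc N. h k j * (if j = k then 1 else 0))"
      by (auto split: if_splits)
    with * show ?thesis by simp
  qed
  show ?case
  proof (cases "h N N = 0")
    case True
    have z: "h N j = 0" if j: "j < N" for j
    proof (rule ccontr)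
      assume b: "h N j \<noteq> 0"
      \<comment> \<open>This choice makes both products for the vector \<open>e\<close> negative:
        \<open>-1\<close> at \<open>j\<close> and \<open>-(h j j + 1)\<close> at
        \<open>N\<close>.\<close>
      define K where "K = - (h j j + 1) / h N j"
      define e where "e = (\<lambda>l. if l = N then K else if l = j then 1 else 0 :: real)"
      have sume: "(\<Sum>l<Suc N. h i l * e l) = h i N * K + h i j" for i
      proof -
        have "(\<Sum>l<N. h i l * e l) = (\<Sum>l<N. if l = j then h i l else 0)"
          by (rule sum.cong) (auto simp: e_def)
        with j show ?thesis by (simp add: e_def)
      qed
      have j1: "e j * (\<Sum>l<Suc N. h j l * e l) < 0"
        unfolding sume using j b by (simp add: e_def K_def sym[of j N])
      have N1: "e N * (\<Sum>l<Suc N. h N l * e l) < 0"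
        unfolding sume using j b True diag[of j] by (simp add: e_def K_def)
      obtain n where "n < Suc N" "e n \<noteq> 0" "0 \<le> e n * (\<Sum>l<Suc N. h n l * e l)"
        using P0[of j e] j by (auto simp: e_def)
      then show False using j1 N1 by (auto simp: e_def split: if_splits)
    qed
    have "0 \<le> (\<Sum>i<N. \<Sum>j<N. c i * c j * h i j)"
    proof (rule Suc.IH[OF sym])
      fix c :: "nat \<Rightarrow> real" and n assume n: "n < N" "c n \<noteq> 0"
      define e where "e = c(N := 0)"
      have "(\<Sum>l<Suc N. h i l * e l) = (\<Sum>l<N. h i l * c l)" for i by (simp add: e_def)
      then show "\<exists>n<N. c n \<noteq> 0 \<and> 0 \<le> c n * (\<Sum>j<N. h n j * c j)"
        using P0[of n e] n by (auto simp: e_def less_Suc_eq split: if_splits)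
    qed
    then show ?thesis unfolding form[OF sym] using z True by simp
  next
    case False
    with diag[of N] have pos: "0 < h N N" by simp
    define g where "g i j = h i j - h i N * h N j / h N N" for i j
    have symg: "g i j = g j i" for i j using sym[of i j] sym[of i N] sym[of j N] by (simp add: g_def)
    have "0 \<le> (\<Sum>i<N. \<Sum>j<N. c i * c j * g i j)"
    proof (rule Suc.IH[OF symg])
      fix c :: "nat \<Rightarrow> real" and n assume n: "n < N" "c n \<noteq> 0"
      show "\<exists>n<N. c n \<noteq> 0 \<and> 0 \<le> c n * (\<Sum>j<N. g n j * c j)"
      proof (rule ccontr)
        assume "\<not> ?thesis"
        then have neg: "\<And>n. n < N \<Longrightarrow> c n \<noteq> 0 \<Longrightarrow> c n * (\<Sum>j<N. g n j * c j) < 0" by force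
        \<comment> \<open>With last coordinate \<open>p\<close> the entry \<open>N\<close> of the
          image vanishes and the others are those of \<open>g\<close>. The factor
          \<open>1 - \<epsilon>\<close> makes the product at \<open>N\<close> negative when
          \<open>p \<noteq> 0\<close>, and small \<open>\<epsilon>\<close> keeps the others
          negative; when \<open>p = 0\<close> the coordinate \<open>N\<close> is zero and cannot be
          the promised index.\<close>
        define p where "p = - (\<Sum>j<N. h N j * c j) / h N N"
        define e where "e \<epsilon> = c(N := p * (1 - \<epsilon>))" for \<epsilon> :: real
        have sumN: "(\<Sum>l<Suc N. h N l * e \<epsilon> l) = - \<epsilon> * p * h N N" for \<epsilon>
          using pos by (simp add: e_def p_def field_simps)
        have sumn: "(\<Sum>l<Suc N. h i l * e \<epsilon> l) = (\<Sum>j<N. g i j * c j) - \<epsilon> * p * h i N" for i \<epsilon>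
        proof -
          have "(\<Sum>j<N. g i j * c j) = (\<Sum>j<N. h i j * c j) + h i N * p"
            using pos by (simp add: g_def p_def left_diff_distrib right_diff_distrib sum_subtractf sum_distrib_left
                sum_divide_distrib mult_ac)
          then show ?thesis by (simp add: e_def algebra_simps)
        qed
        define S where "S = {i. i < N \<and> c i \<noteq> 0}"
        have "\<forall>i\<in>S. \<forall>\<^sub>F \<epsilon> in at_right 0. c i * ((\<Sum>j<N. g i j * c j) - \<epsilon> * p * h i N) < 0"
        proof
          fix i assume "i \<in> S"
          have "((\<lambda>\<epsilon>. c i * ((\<Sum>j<N. g i j * c j) - \<epsilon> * p * h i N)) \<longlongrightarrow>
                c i * ((\<Sum>j<N. g i j * c j) - 0 * p * h i N)) (at_right 0)"
            by (intro tendsto_intros)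
          then show "\<forall>\<^sub>F \<epsilon> in at_right 0. c i * ((\<Sum>j<N. g i j * c j) - \<epsilon> * p * h i N) < 0"
            by (rule order_tendstoD(2)) (use neg \<open>i \<in> S\<close> in \<open>auto simp: S_def\<close>)
        qed
        then have "\<forall>\<^sub>F \<epsilon> in at_right 0. \<forall>i\<in>S. c i * ((\<Sum>j<N. g i j * c j) - \<epsilon> * p * h i N) < 0"
          by (intro eventually_ball_finite) (auto simp: S_def)
        moreover have "\<forall>\<^sub>F \<epsilon> in at_right 0. \<epsilon> < (1::real) \<and> 0 < \<epsilon>"
          unfolding eventually_at_right_field by (auto intro: exI[of _ 1])
        ultimately have "\<forall>\<^sub>F \<epsilon> in at_right 0. (\<forall>i\<in>S. c i * ((\<Sum>j<N. g i j * c j) - \<epsilon> * p * h i N) < 0)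
            \<and> \<epsilon> < 1 \<and> 0 < \<epsilon>"
          by eventually_elim simp
        from eventually_happens'[OF _ this] obtain \<epsilon> where \<epsilon>: "\<And>i. i \<in> S \<Longrightarrow> c i * ((\<Sum>j<N. g i j * c j) - \<epsilon> * p * h i N) < 0"
          "\<epsilon> < 1" "0 < \<epsilon>"
          by (auto simp: trivial_limit_at_right_real)
        obtain k where k: "k < Suc N" "e \<epsilon> k \<noteq> 0" "0 \<le> e \<epsilon> k * (\<Sum>l<Suc N. h k l * e \<epsilon> l)"
          using P0[of n "e \<epsilon>"] n by (auto simp: e_def)
        show False
        proof (cases "k = N")
          case True
          have "e \<epsilon> N * (\<Sum>l<Suc N. h N l * e \<epsilon> l) = - (\<epsilon> * (1 - \<epsilon>) * p\<^sup>2 * h N N)"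
            unfolding sumN by (simp add: e_def power2_eq_square)
          moreover have "p \<noteq> 0" using k(2) True by (auto simp: e_def)
          then have "0 < \<epsilon> * (1 - \<epsilon>) * p\<^sup>2 * h N N"
            using \<epsilon> pos by (intro mult_pos_pos) auto
          ultimately show False using k(3) True by simp
        next
          case False
          with k have "k \<in> S" by (auto simp: S_def e_def)
          then have "e \<epsilon> k * (\<Sum>l<Suc N. h k l * e \<epsilon> l) < 0"
            unfolding sumn using \<epsilon>(1)[of k] False by (simp add: e_def)
          with k(3) show False by simp
        qed
      qed
    qed
    \<comment> \<open>Completing the square in the last coordinate.\<close>
    moreover have "(\<Sum>i<Suc N. \<Sum>j<Suc N. c i * c j * h i j) =
        (\<Sum>i<N. \<Sum>j<N. c i * c j * g i j) + ((\<Sum>j<N. h N j * c j) + c N * h N N)\<^sup>2 / h N N"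
    proof -
      have "c i * c j * g i j = c i * c j * h i j - (h N i * c i) * (h N j * c j) / h N N" for i j
        unfolding g_def sym[of i N] by (simp add: right_diff_distrib)
      then have "(\<Sum>i<N. \<Sum>j<N. c i * c j * g i j) = (\<Sum>i<N. \<Sum>j<N. c i * c j * h i j)
          - (\<Sum>i<N. \<Sum>j<N. (h N i * c i) * (h N j * c j)) / h N N"
        by (simp only: sum_subtractf sum_divide_distrib)
      also have "(\<Sum>i<N. \<Sum>j<N. (h N i * c i) * (h N j * c j)) = (\<Sum>j<N. h N j * c j)\<^sup>2"
        unfolding power2_eq_square sum_product ..
      finally have "(\<Sum>i<N. \<Sum>j<N. c i * c j * g i j) =
          (\<Sum>i<N. \<Sum>j<N. c i * c j * h i j) - (\<Sum>j<N. h N j * c j)\<^sup>2 / h N N" .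
      moreover have "(t + a * b)\<^sup>2 / b = t\<^sup>2 / b + 2 * a * t + a\<^sup>2 * b" if "0 < b" for t a b :: real
        using that by (simp add: field_simps power2_eq_square)
      ultimately show ?thesis unfolding form[OF sym] using pos by simp
    qed
    ultimately show ?thesis using pos by simp
  qed
qed simp

section \<open>The production matrix\<close>

abbreviation unit_seq :: "nat \<Rightarrow> nat \<Rightarrow> 'a::comm_ring_1" where
  "unit_seq k \<equiv> (\<lambda>i. if i = k then 1 else 0)"

text \<open>One-step transfer operator on functions of the height: the value at \<open>h\<close>
  collects the values at the possible next heights, weighted by the step.\<close>

definition step_op :: "nat \<Rightarrow> (nat \<Rightarrow> 'a) \<Rightarrow> (nat \<Rightarrow> 'a) \<Rightarrow> nat \<Rightarrow> 'a::comm_ring_1" where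
  "step_op m \<alpha> \<phi> h = \<phi> (Suc h) + (if m \<le> h then \<alpha> h * \<phi> (h - m) else 0)"

lemma mdyck_paths_same_abscissa:
  "partial_mdyck_paths m (a, h) (a, h') = (if h = h' then {[(a, h)]} else {})"
proof -
  have "ps = [(a, h)]" if "ps \<in> partial_mdyck_paths m (a, h) (a, h')" for ps
  proof -
    from that have "ps \<noteq> []" "hd ps = (a, h)" by (auto simp: partial_mdyck_paths_def)
    moreover from mdyck_path_length(1)[OF that] have "length ps - 1 = 0" by simp
    ultimately show ?thesis by (cases ps) auto
  qed
  moreover have "[(a, h)] \<in> partial_mdyck_paths m (a, h) (a, h') \<longleftrightarrow> h = h'"
    by (auto simp: partial_mdyck_paths_def)
  ultimately show ?thesis by (auto split: if_splits)
qed

lemma mdyck_paths_first_step: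
  assumes "a < fst z"
  shows "partial_mdyck_paths m (a, h) z =
     (#) (a, h) ` (partial_mdyck_paths m (a + 1, Suc h) z \<union>
       (if m \<le> h then partial_mdyck_paths m (a + 1, h - m) z else {}))" (is "?L = ?R")
proof (intro equalityI subsetI)
  fix ps assume ps: "ps \<in> ?L"
  then obtain ps' where ps': "ps = (a, h) # ps'"
    by (cases ps) (auto simp: partial_mdyck_paths_def)
  have ne: "ps' \<noteq> []" using ps ps' assms by (auto simp: partial_mdyck_paths_def)
  then have "mdyck_step m (a, h) (hd ps')" "successively (mdyck_step m) ps'" "last ps' = z"
    using ps ps' by (auto simp: partial_mdyck_paths_def successively_Cons)
  with ne show "ps \<in> ?R"
    unfolding ps' by (cases "hd ps'") (auto simp: partial_mdyck_paths_def mdyck_step_def)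
next
  fix ps assume "ps \<in> ?R"
  then show "ps \<in> ?L"
    by (auto simp: partial_mdyck_paths_def mdyck_step_def successively_Cons split: if_splits)
qed

lemma path_weight_Cons:
  "ps \<noteq> [] \<Longrightarrow> path_weight \<alpha> (p # ps) = step_weight \<alpha> p (hd ps) * path_weight \<alpha> ps"
  by (cases ps) (auto simp: path_weight_def)

text \<open>Induction on the number of steps, splitting off the first one. The endpoint stays fixed,
  so the starting abscissa moves left as \<open>N\<close> grows.\<close>

lemma sum_path_weights:
  fixes \<alpha> :: "nat \<Rightarrow> 'a::comm_ring_1"
  assumes "m \<ge> 1"
  shows "(\<Sum>ps \<in> partial_mdyck_paths m (b - int N, h) (b, h'). path_weight \<alpha> ps) =
    (step_op m \<alpha> ^^ N) (unit_seq h') h"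
proof (induction N arbitrary: h)
  case 0
  then show ?case by (simp add: mdyck_paths_same_abscissa path_weight_def)
next
  case (Suc N)
  let ?a = "b - int (Suc N)" and ?Q = "(b, h')"
  let ?A = "partial_mdyck_paths m (?a + 1, Suc h) ?Q"
  let ?B = "partial_mdyck_paths m (?a + 1, h - m) ?Q"
  have a1: "?a + 1 = b - int N" by simp
  have wA: "(\<Sum>ps\<in>?A. path_weight \<alpha> ((?a, h) # ps)) = (step_op m \<alpha> ^^ N) (unit_seq h') (Suc h)"
    unfolding Suc.IH[symmetric] a1
    by (intro sum.cong refl, subst path_weight_Cons) (auto simp: partial_mdyck_paths_def step_weight_def)
  have wB: "(\<Sum>ps\<in>?B. path_weight \<alpha> ((?a, h) # ps)) = \<alpha> h * (step_op m \<alpha> ^^ N) (unit_seq h') (h - m)"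
    if "m \<le> h"
    unfolding Suc.IH[symmetric] a1 sum_distrib_left
    by (intro sum.cong refl, subst path_weight_Cons)
       (use that assms in \<open>auto simp: partial_mdyck_paths_def step_weight_def\<close>)
  have "?A \<inter> ?B = {}" by (auto simp: partial_mdyck_paths_def)
  then have "(\<Sum>ps \<in> partial_mdyck_paths m (?a, h) ?Q. path_weight \<alpha> ps) =
      (\<Sum>ps\<in>?A. path_weight \<alpha> ((?a, h) # ps)) +
      (if m \<le> h then (\<Sum>ps\<in>?B. path_weight \<alpha> ((?a, h) # ps)) else 0)"
    by (subst mdyck_paths_first_step)
       (auto simp: sum.reindex sum.union_disjoint finite_partial_mdyck_paths)
  with wA wB show ?case by (simp add: step_op_def[of m \<alpha> _ h])
qed

section \<open>A block of \<open>m + 1\<close> steps as a product of bidiagonal matrices\<close>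

definition low :: "'a \<Rightarrow> (nat \<Rightarrow> 'a) \<Rightarrow> nat \<Rightarrow> 'a::comm_ring_1" where
  "low x \<psi> j = \<psi> j + of_nat j * x * \<psi> (j - 1)"

primrec low_prod :: "(nat \<Rightarrow> 'a) \<Rightarrow> nat \<Rightarrow> (nat \<Rightarrow> 'a) \<Rightarrow> nat \<Rightarrow> 'a::comm_ring_1" where
  "low_prod x 0 = id"
| "low_prod x (Suc k) = low_prod x k \<circ> low (x (Suc k))"

definition up :: "'a \<Rightarrow> 'a \<Rightarrow> (nat \<Rightarrow> 'a) \<Rightarrow> nat \<Rightarrow> 'a::comm_ring_1" where
  "up x y \<psi> j = \<psi> (Suc j) + (y + of_nat j * x) * \<psi> j"

definition production_op :: "nat \<Rightarrow> (nat \<Rightarrow> 'a) \<Rightarrow> 'a \<Rightarrow> (nat \<Rightarrow> 'a) \<Rightarrow> nat \<Rightarrow> 'a::comm_ring_1" where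
  "production_op m x y = low_prod x m \<circ> up (x 0) y"

text \<open>A rise to \<open>(m + 1) * j + Suc s\<close> and a fall to
  \<open>(m + 1) * (j - 1) + Suc s\<close> both land in residue \<open>Suc s\<close>, and the fall
  has weight \<open>j * x (Suc s)\<close>. For \<open>j = 0\<close> there is no fall, which agrees
  with the vanishing factor in \<open>low\<close>.\<close>

lemma step_op_residue_less:
  assumes "s < m"
  shows "step_op m (SR_alpha m x y) \<phi> ((m + 1) * j + s) = low (x (Suc s)) (\<lambda>j. \<phi> ((m + 1) * j + Suc s)) j"
proof (cases j)
  case 0
  then show ?thesis using assms by (simp add: step_op_def low_def)
next
  case (Suc i)
  have eq: "(m + 1) * j + s = m + (m + 1) * i + Suc s" by (simp add: Suc)
  have "SR_alpha m x y ((m + 1) * j + s) = of_nat (i + 1) * x (Suc s)"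
    unfolding eq by (rule SR_alpha_pos) (use assms in auto)
  moreover have "(m + 1) * j + s - m = (m + 1) * i + Suc s" unfolding eq by simp
  moreover have "m \<le> (m + 1) * j + s" unfolding eq by simp
  ultimately show ?thesis by (simp add: step_op_def low_def Suc ac_simps)
qed

text \<open>From the top residue both steps land in residue 0: the rise increases the quotient, the
  fall keeps it and has weight \<open>y + j * x 0\<close>.\<close>

lemma step_op_residue_top:
  "step_op m (SR_alpha m x y) \<phi> ((m + 1) * j + m) = up (x 0) y (\<lambda>j. \<phi> ((m + 1) * j)) j"
proof -
  have eq: "(m + 1) * j + m = m + (m + 1) * j" by simp
  show ?thesis unfolding step_op_def up_def eq SR_alpha_0 by (simp add: algebra_simps)
qed

lemma step_op_funpow_residue:
  assumes "k \<le> m"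
  shows "(\<lambda>j. (step_op m (SR_alpha m x y) ^^ k) \<phi> ((m + 1) * j)) =
     low_prod x k (\<lambda>j. \<phi> ((m + 1) * j + k))"
  using assms
proof (induction k arbitrary: \<phi>)
  case (Suc k)
  have "(\<lambda>j. (step_op m (SR_alpha m x y) ^^ Suc k) \<phi> ((m + 1) * j)) =
      (\<lambda>j. (step_op m (SR_alpha m x y) ^^ k) (step_op m (SR_alpha m x y) \<phi>) ((m + 1) * j))"
    by (simp only: funpow_Suc_right comp_def)
  also have "\<dots> = low_prod x k (\<lambda>j. step_op m (SR_alpha m x y) \<phi> ((m + 1) * j + k))"
    using Suc by simp
  also have "\<dots> = low_prod x (Suc k) (\<lambda>j. \<phi> ((m + 1) * j + Suc k))"
    using Suc.prems by (subst step_op_residue_less) auto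
  finally show ?case .
qed simp

text \<open>After \<open>m + 1\<close> steps the residue is 0 again, so on quotients of heights one
  block acts as one factor of the production matrix.\<close>

lemma step_op_production_op:
  "(\<lambda>j. (step_op m (SR_alpha m x y) ^^ ((m + 1) * n)) \<phi> ((m + 1) * j)) =
     (production_op m x y ^^ n) (\<lambda>j. \<phi> ((m + 1) * j))"
proof (induction n arbitrary: \<phi>)
  case (Suc n)
  let ?R = "step_op m (SR_alpha m x y)"
  have "(\<lambda>j. (?R ^^ (m + 1)) \<phi> ((m + 1) * j)) = (\<lambda>j. (?R ^^ m) (?R \<phi>) ((m + 1) * j))"
    by (simp only: funpow_Suc_right comp_def Suc_eq_plus1[symmetric])
  also have "\<dots> = production_op m x y (\<lambda>j. \<phi> ((m + 1) * j))"
    by (subst step_op_funpow_residue)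
       (simp_all only: step_op_residue_top production_op_def comp_def order_refl)
  finally have one: "(\<lambda>j. (?R ^^ (m + 1)) \<phi> ((m + 1) * j)) = production_op m x y (\<lambda>j. \<phi> ((m + 1) * j))" .
  have "(m + 1) * Suc n = (m + 1) * n + (m + 1)" by simp
  then have "(\<lambda>j. (?R ^^ ((m + 1) * Suc n)) \<phi> ((m + 1) * j)) =
      (\<lambda>j. (?R ^^ ((m + 1) * n)) ((?R ^^ (m + 1)) \<phi>) ((m + 1) * j))"
    by (simp only: funpow_add comp_def)
  also have "\<dots> = (production_op m x y ^^ Suc n) (\<lambda>j. \<phi> ((m + 1) * j))"
    unfolding Suc.IH one by (simp only: funpow_Suc_right comp_def)
  finally show ?case .
qed simp

lemma SR_triangle_production_op:
  assumes "m \<ge> 1"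
  shows "SR_triangle m (SR_alpha m x y) n k = (production_op m x y ^^ n) (unit_seq k) 0"
proof -
  have "SR_triangle m (SR_alpha m x y) n k =
      (step_op m (SR_alpha m x y) ^^ ((m + 1) * n)) (unit_seq ((m + 1) * k)) ((m + 1) * 0)"
    unfolding SR_triangle_def
    using sum_path_weights[OF assms, where b = "int ((m + 1) * n)" and N = "(m + 1) * n" and h = 0
      and h' = "(m + 1) * k" and \<alpha> = "SR_alpha m x y"]
    by (simp only: diff_self mult_0_right)
  also have "\<dots> = (production_op m x y ^^ n) (\<lambda>j. unit_seq ((m + 1) * k) ((m + 1) * j)) 0"
    using fun_cong[OF step_op_production_op[where \<phi> = "unit_seq ((m + 1) * k)" and m = m and x = x and y = y and n = n], of 0]
    by simp
  also have "(\<lambda>j. unit_seq ((m + 1) * k) ((m + 1) * j)) = (unit_seq k :: nat \<Rightarrow> 'a)"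
    by (simp only: mult_cancel1) simp
  finally show ?thesis .
qed

section \<open>Scaling the weights and conjugating by the binomial matrix\<close>

lemma low_prod_linear:
  "low_prod x k (\<lambda>j. \<Sum>l\<in>S. c l * \<psi> l j) = (\<lambda>i. \<Sum>l\<in>S. c l * low_prod x k (\<psi> l) i)"
proof (induction k arbitrary: \<psi>)
  case (Suc k)
  have "low (x (Suc k)) (\<lambda>j. \<Sum>l\<in>S. c l * \<psi> l j) = (\<lambda>i. \<Sum>l\<in>S. c l * low (x (Suc k)) (\<psi> l) i)"
    by (simp add: low_def fun_eq_iff sum.distrib sum_distrib_left algebra_simps)
  with Suc.IH show ?case by simp
qed simp

lemma production_op_funpow_linear:
  "(production_op m x y ^^ n) (\<lambda>j. \<Sum>l\<in>S. c l * \<psi> l j) =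
     (\<lambda>i. \<Sum>l\<in>S. c l * (production_op m x y ^^ n) (\<psi> l) i)"
proof (induction n)
  case (Suc n)
  have "up (x 0) y (\<lambda>j. \<Sum>l\<in>S. c l * \<psi> l j) = (\<lambda>i. \<Sum>l\<in>S. c l * up (x 0) y (\<psi> l) i)" for \<psi>
    by (simp add: up_def fun_eq_iff sum.distrib sum_distrib_left algebra_simps)
  with Suc.IH show ?case by (simp add: production_op_def low_prod_linear)
qed simp

text \<open>Conjugation by powers of \<open>v\<close>, written without dividing by \<open>v\<close>
  and therefore limited to indices up to \<open>N\<close>. Each use of \<open>up\<close> lowers
  \<open>N\<close> by one, because it reads one index further.\<close>

definition graded_eq :: "'a::comm_ring_1 \<Rightarrow> nat \<Rightarrow> (nat \<Rightarrow> 'a) \<Rightarrow> (nat \<Rightarrow> 'a) \<Rightarrow> bool" where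
  "graded_eq v N \<eta> \<psi> \<longleftrightarrow> (\<forall>k\<le>N. \<eta> k = v ^ (N - k) * \<psi> k)"

lemma graded_eq_low:
  assumes "graded_eq v N \<eta> \<psi>"
  shows "graded_eq v N (low x \<eta>) (low (v * x) \<psi>)"
  unfolding graded_eq_def
proof (intro allI impI)
  fix k assume k: "k \<le> N"
  show "low x \<eta> k = v ^ (N - k) * low (v * x) \<psi> k"
  proof (cases k)
    case (Suc j)
    with k have "N - j = Suc (N - k)" by simp
    then show ?thesis using assms k Suc by (simp add: graded_eq_def low_def algebra_simps)
  qed (use assms in \<open>simp add: graded_eq_def low_def\<close>)
qed

lemma graded_eq_up:
  assumes "graded_eq v (Suc N) \<eta> \<psi>"
  shows "graded_eq v N (up x y \<eta>) (up (v * x) (v * y) \<psi>)"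
  using assms by (auto simp: graded_eq_def up_def Suc_diff_le algebra_simps)

lemma graded_eq_low_prod:
  "graded_eq v N \<eta> \<psi> \<Longrightarrow> graded_eq v N (low_prod x k \<eta>) (low_prod (\<lambda>i. v * x i) k \<psi>)"
  by (induction k arbitrary: \<eta> \<psi>) (auto intro: graded_eq_low)

lemma graded_eq_production_op:
  "graded_eq v (N + n) \<eta> \<psi> \<Longrightarrow>
     graded_eq v N ((production_op m x y ^^ n) \<eta>) ((production_op m (\<lambda>i. v * x i) (v * y) ^^ n) \<psi>)"
  by (induction n arbitrary: \<eta> \<psi>)
     (auto simp: funpow_Suc_right production_op_def
       simp del: funpow.simps intro!: graded_eq_low_prod graded_eq_up)

definition binomial_op :: "'a \<Rightarrow> (nat \<Rightarrow> 'a) \<Rightarrow> nat \<Rightarrow> 'a::comm_ring_1" where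
  "binomial_op u \<psi> j = (\<Sum>k\<le>j. of_nat (j choose k) * u ^ (j - k) * \<psi> k)"

lemma binomial_op_lin:
  "binomial_op u (\<lambda>k. \<psi> k + c * \<eta> k) j = binomial_op u \<psi> j + c * binomial_op u \<eta> j"
  by (simp add: binomial_op_def sum.distrib sum_distrib_left algebra_simps)

text \<open>Pascal's rule. In operator form: \<open>E exp(uD) = exp(uD) (E + u)\<close>.\<close>

lemma binomial_op_Suc:
  "binomial_op u \<psi> (Suc j) = binomial_op u (\<lambda>k. \<psi> (Suc k) + u * \<psi> k) j"
proof -
  have "binomial_op u \<psi> (Suc j) = u ^ Suc j * \<psi> 0 +
      (\<Sum>k\<le>j. of_nat (j choose k) * u ^ (j - k) * \<psi> (Suc k)) +
      (\<Sum>k\<le>j. of_nat (j choose Suc k) * u ^ (j - k) * \<psi> (Suc k))"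
    unfolding binomial_op_def by (subst sum.atMost_Suc_shift) (simp add: sum.distrib algebra_simps)
  also have "(\<Sum>k\<le>j. of_nat (j choose Suc k) * u ^ (j - k) * \<psi> (Suc k)) =
      (\<Sum>k<j. of_nat (j choose Suc k) * u ^ (j - k) * \<psi> (Suc k))"
    by (rule sum.mono_neutral_right) (auto simp: binomial_eq_0)
  also have "\<dots> = u * (\<Sum>k<j. of_nat (j choose Suc k) * u ^ (j - Suc k) * \<psi> (Suc k))"
    unfolding sum_distrib_left
    by (rule sum.cong) (auto simp: Suc_diff_Suc[symmetric] algebra_simps)
  also have "u ^ Suc j * \<psi> 0 + (\<Sum>k\<le>j. of_nat (j choose k) * u ^ (j - k) * \<psi> (Suc k)) +
      u * (\<Sum>k<j. of_nat (j choose Suc k) * u ^ (j - Suc k) * \<psi> (Suc k)) =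
      binomial_op u (\<lambda>k. \<psi> (Suc k)) j + u * binomial_op u \<psi> j"
    unfolding binomial_op_def
    by (subst (2) sum.atMost_shift) (simp add: algebra_simps)
  also have "\<dots> = binomial_op u (\<lambda>k. \<psi> (Suc k) + u * \<psi> k) j"
    by (simp add: binomial_op_lin)
  finally show ?thesis .
qed

text \<open>Both sides are functions of \<open>D\<close> and hence commute; concretely this is the
  absorption identity for binomial coefficients.\<close>

lemma low_binomial_op: "low x (binomial_op u \<psi>) = binomial_op u (low x \<psi>)"
proof
  fix j
  show "low x (binomial_op u \<psi>) j = binomial_op u (low x \<psi>) j"
  proof (cases j)
    case (Suc i)
    have "binomial_op u (\<lambda>k. of_nat k * \<psi> (k - 1)) (Suc i) =
        (\<Sum>k\<le>i. of_nat (Suc i choose Suc k) * u ^ (i - k) * (of_nat (Suc k) * \<psi> k))"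
      unfolding binomial_op_def by (subst sum.atMost_Suc_shift) simp
    also have "\<dots> = (\<Sum>k\<le>i. of_nat (Suc i) * (of_nat (i choose k) * u ^ (i - k) * \<psi> k))"
    proof (rule sum.cong[OF refl])
      fix k
      have "of_nat (Suc i choose Suc k) * u ^ (i - k) * (of_nat (Suc k) * \<psi> k) =
         of_nat (Suc k * (Suc i choose Suc k)) * (u ^ (i - k) * \<psi> k)"
        by (simp only: of_nat_mult mult_ac)
      also have "\<dots> = of_nat (Suc i) * (of_nat (i choose k) * u ^ (i - k) * \<psi> k)"
        unfolding Suc_times_binomial by (simp only: of_nat_mult mult_ac)
      finally show "of_nat (Suc i choose Suc k) * u ^ (i - k) * (of_nat (Suc k) * \<psi> k) =
         of_nat (Suc i) * (of_nat (i choose k) * u ^ (i - k) * \<psi> k)" .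
    qed
    also have "\<dots> = of_nat (Suc i) * binomial_op u \<psi> i"
      unfolding binomial_op_def sum_distrib_left ..
    finally have "binomial_op u (\<lambda>k. of_nat k * \<psi> (k - 1)) (Suc i) = of_nat (Suc i) * binomial_op u \<psi> i" .
    moreover have "low x \<psi> = (\<lambda>k. \<psi> k + x * (of_nat k * \<psi> (k - 1)))"
      by (simp add: low_def fun_eq_iff algebra_simps)
    ultimately show ?thesis
      by (simp add: Suc binomial_op_lin) (simp add: low_def algebra_simps)
  qed (simp add: low_def binomial_op_def)
qed

lemma low_prod_binomial_op: "low_prod x k (binomial_op u \<psi>) = binomial_op u (low_prod x k \<psi>)"
  by (induction k arbitrary: \<psi>) (simp_all add: low_binomial_op)

definition conj_up :: "'a \<Rightarrow> 'a \<Rightarrow> 'a \<Rightarrow> (nat \<Rightarrow> 'a) \<Rightarrow> nat \<Rightarrow> 'a::comm_ring_1" where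
  "conj_up x y u \<psi> j = low x (\<lambda>k. \<psi> (Suc k) + u * \<psi> k) j + y * \<psi> j"

lemma up_binomial_op: "up x y (binomial_op u \<psi>) = binomial_op u (conj_up x y u \<psi>)"
proof
  fix j
  \<comment> \<open>The factorisation \<open>U = (1 + xD) E + y\<close>, to which the rules for
    \<open>E\<close> and \<open>D\<close> apply separately.\<close>
  have up: "up x y \<eta> j = low x (\<lambda>k. \<eta> (Suc k)) j + y * \<eta> j" for \<eta>
    by (cases j) (simp_all add: up_def low_def algebra_simps)
  show "up x y (binomial_op u \<psi>) j = binomial_op u (conj_up x y u \<psi>) j"
    unfolding up binomial_op_Suc low_binomial_op conj_up_def[abs_def] by (rule binomial_op_lin[symmetric])
qed

definition conj_production_op ::
    "nat \<Rightarrow> (nat \<Rightarrow> 'a) \<Rightarrow> 'a \<Rightarrow> 'a \<Rightarrow> (nat \<Rightarrow> 'a) \<Rightarrow> nat \<Rightarrow> 'a::comm_ring_1" where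
  "conj_production_op m x y u = low_prod x m \<circ> conj_up (x 0) y u"

lemma production_op_binomial_op:
  "(production_op m x y ^^ n) (binomial_op u \<psi>) = binomial_op u ((conj_production_op m x y u ^^ n) \<psi>)"
  by (induction n)
     (simp_all add: production_op_def conj_production_op_def up_binomial_op low_prod_binomial_op)

text \<open>On the combination \<open>\<eta>\<close> of unit vectors, linearity gives the left side.
  Scaling replaces \<open>\<eta>\<close> by the geometric sequence \<open>u ^ j\<close>, which is
  the binomial matrix applied to \<open>unit_seq 0\<close>. Conjugation moves that matrix to the
  front, where it leaves entry 0 unchanged.\<close>

lemma SR_homogeneous_row:
  assumes "m \<ge> 1"
  shows "(\<Sum>k\<le>n. SR_triangle m (SR_alpha m x y) n k * u ^ k * v ^ (n - k)) =
    (conj_production_op m (\<lambda>i. v * x i) (v * y) u ^^ n) (unit_seq 0) 0"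
proof -
  define \<eta> :: "nat \<Rightarrow> 'a" where "\<eta> = (\<lambda>j. \<Sum>k\<le>n. (u ^ k * v ^ (n - k)) * unit_seq k j)"
  have "graded_eq v (0 + n) \<eta> (\<lambda>j. u ^ j)"
  proof -
    have "\<eta> j = u ^ j * v ^ (n - j)" if "j \<le> n" for j
      using that by (simp add: \<eta>_def if_distrib[of "\<lambda>z. _ * _ * z"] cong: if_cong)
    then show ?thesis by (simp add: graded_eq_def mult.commute)
  qed
  from graded_eq_production_op[OF this, of m x y]
  have "(production_op m x y ^^ n) \<eta> 0 = (production_op m (\<lambda>i. v * x i) (v * y) ^^ n) (\<lambda>j. u ^ j) 0"
    by (simp add: graded_eq_def)
  also have "(\<lambda>j. u ^ j) = binomial_op u (unit_seq 0)"
    by (simp add: fun_eq_iff binomial_op_def if_distrib[of "\<lambda>z. _ * z"] cong: if_cong)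
  also have "(production_op m (\<lambda>i. v * x i) (v * y) ^^ n) (binomial_op u (unit_seq 0)) 0 =
      (conj_production_op m (\<lambda>i. v * x i) (v * y) u ^^ n) (unit_seq 0) 0"
    unfolding production_op_binomial_op by (simp add: binomial_op_def)
  also have "(production_op m x y ^^ n) \<eta> 0 =
      (\<Sum>k\<le>n. SR_triangle m (SR_alpha m x y) n k * u ^ k * v ^ (n - k))"
    unfolding \<eta>_def production_op_funpow_linear SR_triangle_production_op[OF assms]
    by (simp add: mult_ac)
  finally show ?thesis .
qed

section \<open>The Hankel matrix as a product of staircases\<close>

text \<open>On \<open>n, j < r\<close> the composition \<open>rows_op P r \<circ> cols_op P r\<close> is the Hankel matrix of the \<open>(0, 0)\<close> entries
  of the powers of \<open>P\<close>.\<close>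

primrec rows_op :: "((nat \<Rightarrow> 'a) \<Rightarrow> nat \<Rightarrow> 'a) \<Rightarrow> nat \<Rightarrow> (nat \<Rightarrow> 'a) \<Rightarrow> nat \<Rightarrow> 'a::comm_ring_1" where
  "rows_op P 0 = (\<lambda>\<psi> i. 0)"
| "rows_op P (Suc r) = shift_op (rows_op P r) \<circ> shift_op P \<circ> (\<lambda>\<psi> i. \<psi> (i - 1))"

primrec cols_op :: "((nat \<Rightarrow> 'a) \<Rightarrow> nat \<Rightarrow> 'a) \<Rightarrow> nat \<Rightarrow> (nat \<Rightarrow> 'a) \<Rightarrow> nat \<Rightarrow> 'a::comm_ring_1" where
  "cols_op P 0 = (\<lambda>\<psi> i. 0)"
| "cols_op P (Suc r) = (\<lambda>\<psi> i. if i = 0 then \<psi> 0 + \<psi> 1 else \<psi> (Suc i)) \<circ> shift_op (P \<circ> cols_op P r)"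

lemma rows_op_eq: "n < r \<Longrightarrow> rows_op P r \<psi> n = (P ^^ n) \<psi> 0"
proof (induction r arbitrary: n \<psi>)
  case (Suc r)
  then show ?case
    by (cases n) (simp_all add: shift_op_def funpow_Suc_right del: funpow.simps)
qed simp

text \<open>Horner's scheme for a polynomial in \<open>P\<close> with coefficients \<open>c\<close>,
  applied to \<open>unit_seq 0\<close>.\<close>

lemma (in pos_cone) cols_op_eq:
  assumes "net P"
  shows "cols_op P r c = (\<lambda>i. \<Sum>j<r. c j * (P ^^ j) (unit_seq 0) i)"
proof (induction r arbitrary: c)
  case (Suc r)
  have "cols_op P (Suc r) c = (\<lambda>i. c 0 * unit_seq 0 i + P (cols_op P r (\<lambda>j. c (Suc j))) i)"
    by (simp add: fun_eq_iff shift_op_def)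
  also have "\<dots> = (\<lambda>i. c 0 * unit_seq 0 i + (\<Sum>j<r. c (Suc j) * P ((P ^^ j) (unit_seq 0)) i))"
    unfolding Suc.IH net_linear[OF assms] ..
  also have "\<dots> = (\<lambda>i. \<Sum>j<Suc r. c j * (P ^^ j) (unit_seq 0) i)"
    by (subst sum.lessThan_Suc_shift) simp
  finally show ?case .
qed simp

lemma low_eq_stair:
  "low x = stair (\<lambda>i. i - 1) (\<lambda>i j. if j = i then 1 else of_nat i * x)"
proof (intro ext)
  fix \<psi> i show "low x \<psi> i = stair (\<lambda>i. i - 1) (\<lambda>i j. if j = i then 1 else of_nat i * x) \<psi> i"
    by (cases i) (simp_all add: low_def stair_def algebra_simps)
qed

text \<open>The second factor duplicates each index \<open>n\<close> into the nodes \<open>2 n\<close> and \<open>2 n + 1\<close>; the additional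
  node \<open>2 n\<close> carries the diagonal term \<open>y\<close>.\<close>

lemma conj_up_eq_stair:
  "conj_up x y u =
     stair (\<lambda>i. 2 * i - 1) (\<lambda>i j. if j = 2 * i + 1 then 1 else if j = 2 * i then y else of_nat i * x) \<circ>
     stair (\<lambda>i. i div 2) (\<lambda>i j. if odd i \<and> j = i div 2 then u else 1)"
  (is "_ = ?A \<circ> ?B")
proof (intro ext)
  fix \<psi> i
  have even: "?B \<psi> (2 * n) = \<psi> n" for n by (simp add: stair_def)
  have odd: "?B \<psi> (Suc (2 * n)) = u * \<psi> n + \<psi> (Suc n)" for n by (simp add: stair_def)
  have A: "?A \<eta> i = \<eta> (Suc (2 * i)) + y * \<eta> (2 * i) + of_nat i * x * \<eta> (2 * i - 1)" for \<eta>
    by (cases i) (simp_all add: stair_def algebra_simps)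
  have "of_nat i * x * ?B \<psi> (2 * i - 1) = of_nat i * x * (\<psi> i + u * \<psi> (i - 1))"
  proof (cases i)
    case (Suc k)
    then have "2 * i - 1 = Suc (2 * k)" by simp
    then show ?thesis unfolding Suc by (simp only: odd) (simp add: add.commute)
  qed simp
  moreover have "conj_up x y u \<psi> i = u * \<psi> i + \<psi> (Suc i) + y * \<psi> i + of_nat i * x * (\<psi> i + u * \<psi> (i - 1))"
    unfolding conj_up_def low_def by (cases i) (simp_all add: algebra_simps)
  ultimately show "conj_up x y u \<psi> i = (?A \<circ> ?B) \<psi> i"
    unfolding comp_def A even odd by simp
qed

context pos_cone
begin

lemma net_zero: "net (\<lambda>\<psi> i. 0)"
proof -
  have "(\<lambda>\<psi> i. 0) = stair id (\<lambda>i j. 0 :: 'a)" by (simp add: stair_def fun_eq_iff)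
  then show ?thesis using net_stair[of id "\<lambda>i j. 0"] by (simp add: mono_def)
qed

lemma net_funpow: "net P \<Longrightarrow> net (P ^^ n)"
  by (induction n) (auto intro: net_id net_comp simp: id_def[symmetric])

lemma net_rows_op: "net P \<Longrightarrow> net (rows_op P r)"
proof (induction r)
  case (Suc r)
  have "(\<lambda>\<psi> i. \<psi> (i - 1)) = stair (\<lambda>i. i - 1) (\<lambda>i j. if j = i - 1 then 1 else 0 :: 'a)"
    by (auto simp: stair_def fun_eq_iff if_distrib[of "\<lambda>z. z * _"] cong: if_cong)
  moreover have "net (stair (\<lambda>i. i - 1) (\<lambda>i j. if j = i - 1 then 1 else 0))"
    by (rule net_stair) (auto simp: mono_def)
  ultimately have "net (\<lambda>\<psi> i. \<psi> (i - 1))" by (simp only:)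
  then show ?case unfolding rows_op.simps by (intro net_comp net_shift_op Suc)
qed (simp add: net_zero)

lemma net_cols_op: "net P \<Longrightarrow> net (cols_op P r)"
proof (induction r)
  case (Suc r)
  have "(\<lambda>\<psi> i. if i = 0 then \<psi> 0 + \<psi> 1 else \<psi> (Suc i)) =
      stair (\<lambda>i. i) (\<lambda>i j. if i = 0 \<or> j = Suc i then 1 else 0 :: 'a)"
    by (auto simp: stair_def fun_eq_iff)
  moreover have "net (stair (\<lambda>i. i) (\<lambda>i j. if i = 0 \<or> j = Suc i then 1 else 0))"
    by (rule net_stair) (auto simp: mono_def)
  ultimately have "net (\<lambda>\<psi> i. if i = 0 then \<psi> 0 + \<psi> 1 else \<psi> (Suc i))" by (simp only:)
  then show ?case unfolding cols_op.simps by (intro net_comp net_shift_op Suc)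
qed (simp add: net_zero)

text \<open>The middle factor \<open>P ^^ e\<close> shifts the sequence; \<open>e = 1\<close> will
  give the second quadratic form of the Stieltjes problem.\<close>

lemma hankel_op_eq:
  assumes "net P" "n < r"
  shows "(rows_op P r \<circ> (P ^^ e) \<circ> cols_op P k) c n = (\<Sum>j<k. c j * (P ^^ (n + e + j)) (unit_seq 0) 0)"
proof -
  have "(rows_op P r \<circ> (P ^^ e) \<circ> cols_op P k) c n =
      (P ^^ (n + e)) (\<lambda>i. \<Sum>j<k. c j * (P ^^ j) (unit_seq 0) i) 0"
    using assms by (simp add: rows_op_eq cols_op_eq funpow_add)
  also have "\<dots> = (\<Sum>j<k. c j * (P ^^ (n + e + j)) (unit_seq 0) 0)"
    unfolding net_linear[OF net_funpow[OF assms(1)]] by (simp add: funpow_add)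
  finally show ?thesis .
qed

lemma net_low_prod: "(\<And>i. i \<le> k \<Longrightarrow> x i \<in> C) \<Longrightarrow> net (low_prod x k)"
proof (induction k)
  case (Suc k)
  have "net (low (x (Suc k)))"
    unfolding low_eq_stair by (rule net_stair) (use Suc.prems in \<open>auto simp: mono_def\<close>)
  then show ?case unfolding low_prod.simps by (intro net_comp Suc.IH Suc.prems) simp_all
qed (simp only: low_prod.simps net_id)

lemma net_conj_production_op:
  assumes "\<And>i. i \<le> m \<Longrightarrow> x i \<in> C" "y \<in> C" "u \<in> C"
  shows "net (conj_production_op m x y u)"
  unfolding conj_production_op_def conj_up_eq_stair
  by (intro net_comp net_low_prod net_stair)
     (use assms in \<open>auto simp: mono_def intro: div_le_mono\<close>)

text \<open>The determinant is the minor of a larger Hankel matrix in rows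
  \<open>p, ..., p + k - 1\<close> and the first \<open>k\<close> columns.\<close>

lemma hankel_det_in:
  assumes "net P"
  shows "Determinant.det (mat k k (\<lambda>(i, j). (P ^^ (p + i + j)) (unit_seq 0) 0)) \<in> C"
proof -
  let ?T = "rows_op P (p + k) \<circ> (P ^^ 0) \<circ> cols_op P k"
  have "net ?T" using assms by (intro net_comp net_rows_op net_cols_op net_funpow)
  from tp_family_net[OF this tp_family_unit]
  have "Determinant.det (mat k k (\<lambda>(i, j). ?T (unit_seq j) (p + i))) \<in> C"
    unfolding tp_family_def by (auto simp: strict_mono_on_def)
  also have "mat k k (\<lambda>(i, j). ?T (unit_seq j) (p + i)) =
      mat k k (\<lambda>(i, j). (P ^^ (p + i + j)) (unit_seq 0) 0)"
  proof (rule eq_matI; clarsimp simp del: comp_apply funpow.simps)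
    fix i j assume "i < k" "j < k"
    then show "?T (unit_seq j) (p + i) = (P ^^ (p + i + j)) (unit_seq 0) 0"
      using hankel_op_eq[OF assms, of "p + i" "p + k" 0 k "unit_seq j"]
      by (simp add: if_distrib[of "\<lambda>z. z * _"] cong: if_cong del: comp_apply)
  qed
  finally show ?thesis .
qed

end

text \<open>By variation diminution the image of a truncated vector cannot have the opposite sign at
  all its nonzero positions. This is the hypothesis of \<open>symmetric_P0_psd\<close>.\<close>

lemma hankel_psd:
  assumes "real_cone.net P"
  shows "0 \<le> (\<Sum>i<N. \<Sum>j<N. c i * c j * (P ^^ (i + e + j)) (unit_seq 0) 0)"
proof (rule symmetric_P0_psd)
  fix i j show "(P ^^ (i + e + j)) (unit_seq 0) 0 = (P ^^ (j + e + i)) (unit_seq 0) 0"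
    by (simp add: add_ac)
next
  fix c :: "nat \<Rightarrow> real" and n assume n: "n < N" "c n \<noteq> 0"
  let ?T = "rows_op P N \<circ> (P ^^ e) \<circ> cols_op P N"
  define c' where "c' = (\<lambda>j. if j < N then c j else 0)"
  have "real_cone.net ?T"
    using assms by (intro real_cone.net_comp real_cone.net_rows_op real_cone.net_cols_op real_cone.net_funpow)
  then have "\<exists>n. c' n \<noteq> 0 \<and> 0 \<le> c' n * ?T c' n"
    by (intro not_alternates_negated[where N = N]) (use n in \<open>auto simp: c'_def dest: alternates_net\<close>)
  then show "\<exists>n<N. c n \<noteq> 0 \<and> 0 \<le> c n * (\<Sum>j<N. (P ^^ (n + e + j)) (unit_seq 0) 0 * c j)"
    by (auto simp: c'_def real_cone.hankel_op_eq[OF assms] mult.commute simp del: comp_apply split: if_splits)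
qed

section \<open>Iterated log-convexity\<close>

lemma det_mat_expand_first_row:
  "Determinant.det (mat (Suc n) (Suc n) f) =
     (\<Sum>j<Suc n. f (0, j) * (-1) ^ j *
        Determinant.det (mat n n (\<lambda>(i, l). f (Suc i, if l < j then l else Suc l))))"
proof -
  have "Determinant.det (mat (Suc n) (Suc n) f) =
      (\<Sum>j<Suc n. mat (Suc n) (Suc n) f $$ (0, j) * cofactor (mat (Suc n) (Suc n) f) 0 j)"
    by (rule laplace_expansion_row) auto
  also have "\<dots> = (\<Sum>j<Suc n. f (0, j) * (-1) ^ j *
        Determinant.det (mat n n (\<lambda>(i, l). f (Suc i, if l < j then l else Suc l))))"
  proof (rule sum.cong[OF refl])
    fix j assume j: "j \<in> {..<Suc n}"
    have "mat_delete (mat (Suc n) (Suc n) f) 0 j = mat n n (\<lambda>(i, l). f (Suc i, if l < j then l else Suc l))"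
      by (rule eq_matI) (auto simp: mat_delete_def)
    with j show "mat (Suc n) (Suc n) f $$ (0, j) * cofactor (mat (Suc n) (Suc n) f) 0 j =
        f (0, j) * (-1) ^ j * Determinant.det (mat n n (\<lambda>(i, l). f (Suc i, if l < j then l else Suc l)))"
      by (simp add: cofactor_def)
  qed
  finally show ?thesis .
qed

lemma det_mat_0: "Determinant.det (mat 0 0 f) = 1"
  by (simp add: Determinant.det_def)

abbreviation hankel_det :: "(nat \<Rightarrow> 'a) \<Rightarrow> nat \<Rightarrow> nat \<Rightarrow> 'a::comm_ring_1" where
  "hankel_det a p k \<equiv> Determinant.det (mat k k (\<lambda>(i, j). a (p + i + j)))"

lemma hankel_det_1: "hankel_det a p 1 = a p"
  by (simp add: det_mat_expand_first_row det_mat_0)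

lemma hankel_det_2: "hankel_det a p 2 = a p * a (p + 2) - (a (p + 1))\<^sup>2"
  by (simp add: numeral_2_eq_2 det_mat_expand_first_row det_mat_0 power2_eq_square)

lemma hankel_det_3:
  "hankel_det a p 3 = a p * a (p + 2) * a (p + 4) + 2 * a (p + 1) * a (p + 2) * a (p + 3)
     - (a (p + 2)) ^ 3 - a p * (a (p + 3))\<^sup>2 - (a (p + 1))\<^sup>2 * a (p + 4)"
  by (simp add: eval_nat_numeral det_mat_expand_first_row det_mat_0 algebra_simps)

text \<open>The Desnanot-Jacobi identity; by symmetry of Hankel matrices the two mixed minors
  coincide and give a square.\<close>

lemma hankel_det_4_dodgson:
  "hankel_det a p 4 * hankel_det a (p + 2) 2 =
     hankel_det a p 3 * hankel_det a (p + 2) 3 - (hankel_det a (p + 1) 3)\<^sup>2"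
  by (simp add: eval_nat_numeral det_mat_expand_first_row det_mat_0 algebra_simps)

text \<open>Desnanot-Jacobi for order 3, whose central minor is the single entry
  \<open>a (p + 2)\<close>.\<close>

lemma log_op_2_eq_hankel_det:
  "(log_op ^^ 2) a (p + 2) = a (p + 2) * hankel_det a p 3"
  unfolding hankel_det_3
  by (simp add: eval_nat_numeral log_op_def algebra_simps)

lemma log_op_1_eq_hankel_det: "log_op a (p + 1) = hankel_det a p 2"
  by (simp add: hankel_det_2 log_op_def)

text \<open>Replacing the product of the two outer order 3 minors leaves the square of the middle
  one with coefficient \<open>a (p + 2) * a (p + 4) - (a (p + 3))\<^sup>2\<close>, itself a Hankel
  minor. Hence no negative term remains.\<close>

lemma log_op_3_eq_hankel_det:
  "(log_op ^^ 3) a (p + 3) = hankel_det a (p + 2) 2 * (hankel_det a (p + 1) 3)\<^sup>2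
     + a (p + 2) * a (p + 4) * (hankel_det a p 4 * hankel_det a (p + 2) 2)"
proof -
  have "(log_op ^^ 3) a (p + 3) = log_op ((log_op ^^ 2) a) (p + 3)"
    by (simp add: eval_nat_numeral)
  also have "\<dots> = (log_op ^^ 2) a (p + 2) * (log_op ^^ 2) a (p + 2 + 2) - ((log_op ^^ 2) a (p + 1 + 2))\<^sup>2"
    unfolding log_op_def[of _ "p + 3"] by (simp add: eval_nat_numeral)
  also have "\<dots> = a (p + 2) * a (p + 4) * (hankel_det a p 3 * hankel_det a (p + 2) 3)
      - (a (p + 3))\<^sup>2 * (hankel_det a (p + 1) 3)\<^sup>2"
    unfolding log_op_2_eq_hankel_det by (simp add: power_mult_distrib ac_simps numeral_eq_Suc)
  also have "hankel_det a p 3 * hankel_det a (p + 2) 3 =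
      hankel_det a p 4 * hankel_det a (p + 2) 2 + (hankel_det a (p + 1) 3)\<^sup>2"
    unfolding hankel_det_4_dodgson by simp
  also have "a (p + 2) * a (p + 4) * (hankel_det a p 4 * hankel_det a (p + 2) 2 + (hankel_det a (p + 1) 3)\<^sup>2)
      - (a (p + 3))\<^sup>2 * (hankel_det a (p + 1) 3)\<^sup>2 =
      (a (p + 2) * a (p + 2 + 2) - (a (p + 2 + 1))\<^sup>2) * (hankel_det a (p + 1) 3)\<^sup>2
     + a (p + 2) * a (p + 4) * (hankel_det a p 4 * hankel_det a (p + 2) 2)"
    by (simp add: algebra_simps eval_nat_numeral)
  finally show ?thesis unfolding hankel_det_2[of a "p + 2", symmetric] .
qed

lemma (in pos_cone) log_op_in:
  assumes hankel: "\<And>p k. hankel_det a p k \<in> C" and "k \<le> 3" "k \<le> i"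
  shows "(log_op ^^ k) a i \<in> C"
proof -
  have a: "a p \<in> C" for p using hankel[of 1 p] unfolding hankel_det_1 .
  define p where "p = i - k"
  have i: "i = p + k" using assms(3) by (simp add: p_def)
  consider "k = 0" | "k = 1" | "k = 2" | "k = 3" using assms(2) by linarith
  then show ?thesis
  proof cases
    case 1 then show ?thesis using a by simp
  next
    case 2 then show ?thesis unfolding i using log_op_1_eq_hankel_det[of a p] hankel by simp
  next
    case 3 show ?thesis unfolding i 3 log_op_2_eq_hankel_det by (intro mult_in a hankel)
  next
    case 4 show ?thesis unfolding i 4 log_op_3_eq_hankel_det power2_eq_square
      by (intro mult_in add_in a hankel)
  qed
qed

lemma nonneg_coeffs_cone: "pos_cone {p :: 'v mpoly. nonneg_coeffs p}"
proof
  fix p q :: "'v mpoly" assume "p \<in> {p. nonneg_coeffs p}" "q \<in> {p. nonneg_coeffs p}"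
  then have pq: "\<And>t. 0 \<le> Poly_Mapping.lookup p t" "\<And>t. 0 \<le> Poly_Mapping.lookup q t" by (auto simp: nonneg_coeffs_def)
  then show "p + q \<in> {p. nonneg_coeffs p}" by (auto simp: nonneg_coeffs_def lookup_add)
  have nn: "0 \<le> Sum_any g" if "\<And>t. 0 \<le> g t" for g :: "'b \<Rightarrow> real"
    using that by (auto simp: Sum_any.expand_set intro: sum_nonneg)
  show "p * q \<in> {p. nonneg_coeffs p}"
    unfolding nonneg_coeffs_def lookup_mult mem_Collect_eq
    by (intro allI nn mult_nonneg_nonneg pq) (simp add: when_def pq)
qed (auto simp: nonneg_coeffs_def lookup_one when_def)

lemma nonneg_coeffs_indet: "nonneg_coeffs (indet v)"
  by (simp add: nonneg_coeffs_def indet_def lookup_single when_def)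

text \<open>The homogeneous form in \<open>u\<close> and \<open>v\<close> treats the row polynomials
  (\<open>v = 1\<close>) and their reversals (\<open>u = 1\<close>) together.\<close>

lemma log_convex_SR_rows:
  assumes "m \<ge> 1" "\<And>i. nonneg_coeffs (x i)" "nonneg_coeffs y" "nonneg_coeffs u" "nonneg_coeffs v"
  shows "mpoly_log_convex 3 (\<lambda>n. \<Sum>k\<le>n. SR_triangle m (SR_alpha m x y) n k * u ^ k * v ^ (n - k))"
proof -
  interpret pos_cone "{p :: 'a mpoly. nonneg_coeffs p}" by (rule nonneg_coeffs_cone)
  have "net (conj_production_op m (\<lambda>i. v * x i) (v * y) u)"
    by (rule net_conj_production_op; (intro mult_in)?) (use assms in auto)
  from log_op_in[OF hankel_det_in[OF this]] show ?thesis
    unfolding mpoly_log_convex_def SR_homogeneous_row[OF assms(1)] by blast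
qed

section \<open>The Stieltjes moment problem\<close>

lemma poly_nonneg_at_limit:
  fixes r :: "real poly"
  assumes "\<And>x. a < x \<Longrightarrow> 0 \<le> poly r x"
  shows "0 \<le> poly r a"
proof (rule tendsto_lowerbound)
  show "(poly r \<longlongrightarrow> poly r a) (at_right a)" by (intro tendsto_intros)
  show "\<forall>\<^sub>F x in at_right a. 0 \<le> poly r x"
    using assms by (auto simp: eventually_at_filter)
qed simp

lemma poly_nonneg_attains_inf:
  fixes p :: "real poly"
  assumes nn: "\<And>x. 0 \<le> x \<Longrightarrow> 0 \<le> poly p x" and "degree p \<noteq> 0"
  obtains x0 where "0 \<le> x0" "\<And>x. 0 \<le> x \<Longrightarrow> poly p x0 \<le> poly p x"
proof -
  obtain b q where p: "p = pCons b q" by (cases p)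
  with assms(2) have q: "q \<noteq> 0" by auto
  have "0 < lead_coeff q"
  proof (rule ccontr)
    assume "\<not> ?thesis"
    define l where "l = lead_coeff (- q)"
    have lc: "0 < l"
      using q \<open>\<not> 0 < lead_coeff q\<close> by (simp add: l_def lead_coeff_minus order.strict_iff_order)
    from poly_pinfty_gt_lc[of "- q"] lc obtain n where n: "\<And>x. n \<le> x \<Longrightarrow> l \<le> poly (- q) x"
      unfolding l_def by blast
    \<comment> \<open>Far enough out for \<open>poly (- q) x \<ge> l\<close> and for
      \<open>x * l\<close> to exceed \<open>b\<close>, so that \<open>b + x * poly q x\<close> is
      negative.\<close>
    define x where "x = max (max 0 n) (b / l + 1)"
    have x: "0 \<le> x" "n \<le> x" "b / l + 1 \<le> x" by (auto simp: x_def)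
    have "b + l \<le> x * l" using x(3) lc by (simp add: field_simps)
    also have "\<dots> \<le> x * poly (- q) x" using n[OF x(2)] x(1) by (rule mult_left_mono)
    finally have "poly p x < 0" using lc by (simp add: p)
    with nn[OF x(1)] show False by simp
  qed
  from poly_pinfty_gt_lc[OF this] obtain n where n: "\<And>x. n \<le> x \<Longrightarrow> lead_coeff q \<le> poly q x" by blast
  obtain x0 where x0: "x0 \<in> {0..max 0 n}" "\<And>x. x \<in> {0..max 0 n} \<Longrightarrow> poly p x0 \<le> poly p x"
    using continuous_attains_inf[of "{0..max 0 n}" "poly p"] continuous_at_imp_continuous_on[of "{0..max 0 n}" "poly p"]
    by auto
  have "poly p x0 \<le> poly p x" if "0 \<le> x" for x
  proof (cases "x \<le> max 0 n")
    case False
    then have "n \<le> x" by simp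
    from n[OF this] have "0 \<le> poly q x" using \<open>0 < lead_coeff q\<close> by linarith
    then have "poly p 0 \<le> poly p x" using that by (simp add: p)
    with x0(2)[of 0] show ?thesis by simp
  qed (use that x0 in auto)
  with x0(1) show ?thesis using that by auto
qed

text \<open>Subtracting the minimum on the half line leaves a polynomial divisible by \<open>x\<close> or by the
  square of a linear factor, so that Lukacs' representation is obtained by induction.\<close>

lemma nonneg_poly_functional:
  fixes \<Lambda> :: "real poly \<Rightarrow> real"
  assumes "\<And>p q. \<Lambda> (p + q) = \<Lambda> p + \<Lambda> q"
    and "\<And>q. 0 \<le> \<Lambda> (q * q)" and "\<And>q. 0 \<le> \<Lambda> ([:0, 1:] * (q * q))"
    and "\<And>x. 0 \<le> x \<Longrightarrow> 0 \<le> poly p x"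
  shows "0 \<le> \<Lambda> p"
  using assms
proof (induction "degree p" arbitrary: p \<Lambda> rule: less_induct)
  case less
  note add = less.prems(1) and sq = less.prems(2) and xsq = less.prems(3) and nn = less.prems(4)
  have const: "0 \<le> \<Lambda> [:c:]" if "0 \<le> c" for c
    using sq[of "[:sqrt c:]"] that by simp
  show ?case
  proof (cases "degree p = 0")
    case True
    then obtain c where c: "p = [:c:]" by (auto elim: degree_eq_zeroE)
    with nn[of 0] const[of c] show ?thesis by simp
  next
    case False
    obtain x0 where x0: "0 \<le> x0" "\<And>x. 0 \<le> x \<Longrightarrow> poly p x0 \<le> poly p x"
      using poly_nonneg_attains_inf[OF nn False] by blast
    define q where "q = p - [:poly p x0:]"
    have p: "\<Lambda> p = \<Lambda> [:poly p x0:] + \<Lambda> q" by (simp add: q_def flip: add)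
    have qnn: "0 \<le> poly q x" if "0 \<le> x" for x using x0(2)[OF that] by (simp add: q_def)
    have degq: "degree q \<le> degree p" unfolding q_def by (rule degree_diff_le) auto
    have "poly q x0 = 0" by (simp add: q_def)
    then obtain r where r: "q = [:- x0, 1:] * r" by (auto simp: poly_eq_0_iff_dvd)
    have "q \<noteq> 0"
    proof
      assume "q = 0"
      then have "p = [:poly p x0:]" by (simp only: q_def right_minus_eq)
      from arg_cong[OF this, of degree] False show False by (simp only: degree_pCons_0)
    qed
    then have "r \<noteq> 0" using r by auto
    then have degr: "degree q = Suc (degree r)" unfolding r by (subst degree_mult_eq) auto
    have qr: "poly q x = (x - x0) * poly r x" for x by (simp add: r algebra_simps)
    have r_right: "0 \<le> poly r x" if "x0 < x" for x
      using qnn[of x] that x0(1) by (auto simp: qr zero_le_mult_iff)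
    have "0 \<le> \<Lambda> q"
    proof (cases "x0 = 0")
      case True
      have rnn: "0 \<le> poly r x" if "0 \<le> x" for x
        using that r_right True poly_nonneg_at_limit[of 0 r] by (cases "x = 0") auto
      have "0 \<le> \<Lambda> ([:0, 1:] * r)"
      \<comment> \<open>The factor is absorbed into the functional, which exchanges the roles of
        squares and of \<open>x\<close> times squares.\<close>
      proof (rule less.hyps[of r "\<lambda>s. \<Lambda> ([:0, 1:] * s)"])
        show "degree r < degree p" using degr degq by simp
        show "0 \<le> \<Lambda> ([:0, 1:] * ([:0, 1:] * (s * s)))" for s
          using sq[of "[:0, 1:] * s"] by (simp only: mult_ac)
      qed (simp_all only: add distrib_left xsq rnn)
      then show ?thesis unfolding r True by (simp only: minus_zero)
    next
      case False
      with x0(1) have x0pos: "0 < x0" by simp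
      \<comment> \<open>At an interior minimum \<open>x - x0\<close> changes sign while
        \<open>q\<close> does not, so \<open>r\<close> vanishes at \<open>x0\<close> and the root is
        at least double.\<close>
      have "0 \<le> poly r x0" using poly_nonneg_at_limit r_right by blast
      moreover have "poly r x0 \<le> 0"
      proof (rule tendsto_upperbound)
        show "(poly r \<longlongrightarrow> poly r x0) (at_left x0)" by (intro tendsto_intros)
        have "poly r x \<le> 0" if "0 < x" "x < x0" for x
          using qnn[of x] that by (auto simp: qr zero_le_mult_iff)
        then show "\<forall>\<^sub>F x in at_left x0. poly r x \<le> 0"
          using x0pos by (auto simp: eventually_at_left_field intro!: exI[of _ 0])
      qed simp
      ultimately obtain t where t: "r = [:- x0, 1:] * t" by (auto simp: poly_eq_0_iff_dvd)
      have t_off: "0 \<le> poly t x" if "0 \<le> x" "x \<noteq> x0" for x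
      proof -
        have "poly q x = (x - x0)\<^sup>2 * poly t x" by (simp add: qr t power2_eq_square algebra_simps)
        with qnn[OF that(1)] that(2) show ?thesis by (simp add: zero_le_mult_iff)
      qed
      have tnn: "0 \<le> poly t x" if "0 \<le> x" for x
        using that t_off x0(1) poly_nonneg_at_limit[of x0 t] by (cases "x = x0") auto
      have "0 \<le> \<Lambda> ([:- x0, 1:] * [:- x0, 1:] * t)"
      proof (rule less.hyps[of t "\<lambda>s. \<Lambda> ([:- x0, 1:] * [:- x0, 1:] * s)"])
        have "degree t \<le> degree r" unfolding t using \<open>r \<noteq> 0\<close> t by (subst degree_mult_eq) auto
        then show "degree t < degree p" using degr degq by simp
        show "0 \<le> \<Lambda> ([:- x0, 1:] * [:- x0, 1:] * (s * s))" for s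
          using sq[of "[:- x0, 1:] * s"] by (simp only: mult_ac)
        show "0 \<le> \<Lambda> ([:- x0, 1:] * [:- x0, 1:] * ([:0, 1:] * (s * s)))" for s
          using xsq[of "[:- x0, 1:] * s"] by (simp only: mult_ac)
      qed (simp_all only: add distrib_left tnn)
      then show ?thesis unfolding r t by (simp only: mult.assoc)
    qed
    then show ?thesis using p const[of "poly p x0"] nn[OF x0(1)] by simp
  qed
qed

section \<open>M. Riesz extension to countably many bounded functions\<close>

lemma riesz_extension_step:
  fixes \<Lambda> :: "real poly \<Rightarrow> real" and g :: "nat \<Rightarrow> real \<Rightarrow> real"
  assumes add: "\<And>p q. \<Lambda> (p + q) = \<Lambda> p + \<Lambda> q" and smult: "\<And>c p. \<Lambda> (Polynomial.smult c p) = c * \<Lambda> p"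
    and g: "\<And>i x. 0 \<le> g i x" "\<And>i x. g i x \<le> 1"
    and pos: "\<And>p b. (\<And>x. 0 \<le> x \<Longrightarrow> 0 \<le> poly p x + (\<Sum>i<n. b i * g i x)) \<Longrightarrow> 0 \<le> \<Lambda> p + (\<Sum>i<n. b i * c i)"
  shows "\<exists>d. \<forall>p b. (\<forall>x\<ge>0. 0 \<le> poly p x + (\<Sum>i<n. b i * g i x) + b n * g n x) \<longrightarrow>
     0 \<le> \<Lambda> p + (\<Sum>i<n. b i * c i) + b n * d"
proof -
  \<comment> \<open>The values on majorants of \<open>g n\<close>; the new value \<open>d\<close> is
    their infimum. The bounds on \<open>g\<close> make \<open>E\<close> nonempty and bounded below
    by 0.\<close>
  define E where "E = {\<Lambda> p + (\<Sum>i<n. b i * c i) | p b.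
    \<forall>x\<ge>0. g n x \<le> poly p x + (\<Sum>i<n. b i * g i x)}"
  have "\<Lambda> [:1:] + (\<Sum>i<n. 0 * c i) \<in> E"
    unfolding E_def using g(2) by (intro CollectI exI[of _ "[:1:]"] exI[of _ "\<lambda>_. 0"]) auto
  then have ne: "E \<noteq> {}" by blast
  have "0 \<le> v" if "v \<in> E" for v
  proof -
    from that obtain p b where v: "v = \<Lambda> p + (\<Sum>i<n. b i * c i)"
      and h: "\<And>x. 0 \<le> x \<Longrightarrow> g n x \<le> poly p x + (\<Sum>i<n. b i * g i x)"
      unfolding E_def by blast
    show ?thesis unfolding v by (rule pos) (rule order_trans[OF g(1) h])
  qed
  then have bdd: "bdd_below E" by (rule bdd_belowI)
  have "0 \<le> \<Lambda> p + (\<Sum>i<n. b i * c i) + b n * Inf E"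
    if h: "\<forall>x\<ge>0. 0 \<le> poly p x + (\<Sum>i<n. b i * g i x) + b n * g n x" for p b
  proof -
    let ?V = "\<Lambda> p + (\<Sum>i<n. b i * c i)"
    consider "b n = 0" | "0 < b n" | "b n < 0" by linarith
    then show ?thesis
    proof cases
      case 1
      then show ?thesis using pos[of p b] h by simp
    next
      case 2
      \<comment> \<open>Adding the given function divided by \<open>b n\<close> to any majorant of
        \<open>g n\<close> cancels \<open>g n\<close>, and \<open>pos\<close> applies to what is
        left.\<close>
      have "- ?V / b n \<le> Inf E"
      proof (rule cInf_greatest[OF ne])
        fix v assume "v \<in> E"
        then obtain p' b' where v: "v = \<Lambda> p' + (\<Sum>i<n. b' i * c i)"
          and h': "\<And>x. 0 \<le> x \<Longrightarrow> g n x \<le> poly p' x + (\<Sum>i<n. b' i * g i x)"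
          unfolding E_def by blast
        have "0 \<le> \<Lambda> (p' + Polynomial.smult (1 / b n) p) + (\<Sum>i<n. (b' i + b i / b n) * c i)"
        proof (rule pos)
          fix x :: real assume x: "0 \<le> x"
          have "0 \<le> (poly p x + (\<Sum>i<n. b i * g i x) + b n * g n x) / b n"
            using h x 2 by simp
          also have "\<dots> = poly p x / b n + (\<Sum>i<n. b i / b n * g i x) + g n x"
            using 2 by (simp add: add_divide_distrib sum_divide_distrib)
          finally show "0 \<le> poly (p' + Polynomial.smult (1 / b n) p) x + (\<Sum>i<n. (b' i + b i / b n) * g i x)"
            using h'[OF x] by (simp add: distrib_right sum.distrib)
        qed
        also have "\<dots> = v + ?V / b n"
          by (simp add: v add smult distrib_right sum.distrib sum_divide_distrib add_divide_distrib)
        finally have "- (?V / b n) \<le> v" by linarith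
        then show "- ?V / b n \<le> v" by (simp only: minus_divide_left)
      qed
      then have "- ?V \<le> Inf E * b n" using 2 by (simp add: pos_divide_le_eq)
      then show ?thesis by (simp add: mult.commute)
    next
      case 3
      \<comment> \<open>Dividing by \<open>- b n\<close> turns the given inequality into a majorant
        of \<open>g n\<close>.\<close>
      have "\<Lambda> (Polynomial.smult (1 / - b n) p) + (\<Sum>i<n. (b i / - b n) * c i) \<in> E"
        unfolding E_def
      proof (rule CollectI, rule exI[of _ "Polynomial.smult (1 / - b n) p"], rule exI[of _ "\<lambda>i. b i / - b n"],
          intro conjI allI impI refl)
        fix x :: real assume x: "0 \<le> x"
        have "0 \<le> (poly p x + (\<Sum>i<n. b i * g i x) + b n * g n x) / - b n"
          by (rule divide_nonneg_pos) (use h x 3 in auto)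
        also have "\<dots> = poly p x / - b n + (\<Sum>i<n. b i / - b n * g i x) - g n x"
          using 3 by (simp add: add_divide_distrib sum_divide_distrib sum_negf diff_divide_distrib)
        finally show "g n x \<le> poly (Polynomial.smult (1 / - b n) p) x + (\<Sum>i<n. b i / - b n * g i x)"
          by simp
      qed
      from cInf_lower[OF this bdd] have "Inf E \<le> (1 / - b n) * \<Lambda> p + (\<Sum>i<n. b i / - b n * c i)"
        by (simp only: smult)
      also have "\<dots> = ?V / - b n"
        by (simp add: add_divide_distrib sum_divide_distrib sum_negf diff_divide_distrib)
      finally have "Inf E \<le> ?V / - b n" .
      then have "Inf E * - b n \<le> ?V" using 3 by (subst (asm) pos_le_divide_eq) auto
      then show ?thesis by (simp add: mult.commute)
    qed
  qed
  then show ?thesis by blast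
qed

lemma riesz_extension:
  fixes \<Lambda> :: "real poly \<Rightarrow> real" and g :: "nat \<Rightarrow> real \<Rightarrow> real"
  assumes add: "\<And>p q. \<Lambda> (p + q) = \<Lambda> p + \<Lambda> q" and smult: "\<And>c p. \<Lambda> (Polynomial.smult c p) = c * \<Lambda> p"
    and g: "\<And>i x. 0 \<le> g i x" "\<And>i x. g i x \<le> 1"
    and pos: "\<And>p. (\<And>x. 0 \<le> x \<Longrightarrow> 0 \<le> poly p x) \<Longrightarrow> 0 \<le> \<Lambda> p"
  shows "\<exists>c. \<forall>n p b. (\<forall>x\<ge>0. 0 \<le> poly p x + (\<Sum>i<n. b i * g i x)) \<longrightarrow> 0 \<le> \<Lambda> p + (\<Sum>i<n. b i * c i)"
proof -
  define Pos where "Pos n c \<longleftrightarrow> (\<forall>p b. (\<forall>x\<ge>0. 0 \<le> poly p x + (\<Sum>i<n. b i * g i x)) \<longrightarrow>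
      0 \<le> \<Lambda> p + (\<Sum>i<n. b i * c i))" for n c
  have cong: "Pos n c \<longleftrightarrow> Pos n c'" if "\<And>i. i < n \<Longrightarrow> c i = c' i" for n c c'
    using that unfolding Pos_def by simp
  have "\<exists>f. \<forall>n. Pos n (f n) \<and> (\<forall>i<n. f (Suc n) i = f n i)"
  proof (rule dependent_nat_choice)
    show "\<exists>c. Pos 0 c" using pos by (auto simp: Pos_def)
    fix c n assume "Pos n c"
    then have "0 \<le> \<Lambda> p + (\<Sum>i<n. b i * c i)"
      if "\<And>x. 0 \<le> x \<Longrightarrow> 0 \<le> poly p x + (\<Sum>i<n. b i * g i x)" for p b
      using that unfolding Pos_def by simp
    from riesz_extension_step[where \<Lambda> = \<Lambda> and g = g and n = n and c = c, OF add smult g this]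
    obtain d where "\<forall>p b. (\<forall>x\<ge>0. 0 \<le> poly p x + (\<Sum>i<n. b i * g i x) + b n * g n x) \<longrightarrow>
        0 \<le> \<Lambda> p + (\<Sum>i<n. b i * c i) + b n * d" ..
    then have "Pos (Suc n) (c(n := d))" by (simp add: Pos_def add.assoc)
    then show "\<exists>c'. Pos (Suc n) c' \<and> (\<forall>i<n. c' i = c i)" by (intro exI[of _ "c(n := d)"]) auto
  qed
  then obtain f where f: "\<And>n. Pos n (f n)" "\<And>n i. i < n \<Longrightarrow> f (Suc n) i = f n i" by blast
  \<comment> \<open>Later stages keep earlier values, so the diagonal sequence agrees with every
    stage.\<close>
  have "f (Suc i + k) i = f (Suc i) i" for i k by (induction k) (auto simp: f(2))
  then have diag: "f n i = f (Suc i) i" if "i < n" for n i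
    using le_Suc_ex[OF Suc_leI[OF that]] by auto
  have "Pos n (\<lambda>i. f (Suc i) i)" for n
    by (rule iffD1[OF cong[of n "f n"] f(1)]) (rule diag)
  then have "\<forall>n. Pos n (\<lambda>i. f (Suc i) i)" ..
  then show ?thesis unfolding Pos_def by (rule exI[of _ "\<lambda>i. f (Suc i) i"])
qed

section \<open>The moment functional and its extension to half lines\<close>

definition moment_functional :: "(nat \<Rightarrow> real) \<Rightarrow> real poly \<Rightarrow> real" where
  "moment_functional a p = (\<Sum>i\<le>degree p. coeff p i * a i)"

lemma moment_functional_bound:
  assumes "degree p \<le> N"
  shows "moment_functional a p = (\<Sum>i\<le>N. coeff p i * a i)"
  unfolding moment_functional_def using assms
  by (intro sum.mono_neutral_left) (auto simp: coeff_eq_0 not_le)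

lemma moment_functional_add:
  "moment_functional a (p + q) = moment_functional a p + moment_functional a q"
proof -
  let ?N = "max (degree p) (degree q)"
  have "degree (p + q) \<le> ?N" by (rule degree_add_le_max)
  then show ?thesis
    by (simp add: moment_functional_bound[of _ ?N] distrib_right sum.distrib)
qed

lemma moment_functional_smult: "moment_functional a (Polynomial.smult c p) = c * moment_functional a p"
  using moment_functional_bound[OF degree_smult_le, of a c p]
  by (simp add: moment_functional_def sum_distrib_left mult_ac)

lemma moment_functional_sum:
  "moment_functional a (sum f S) = (\<Sum>i\<in>S. moment_functional a (f i))"
proof (induction S rule: infinite_finite_induct)
  case (insert i S)
  then show ?case by (simp add: moment_functional_add)
qed (simp_all add: moment_functional_def)

lemma moment_functional_monom: "moment_functional a (monom c k) = c * a k"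
  by (subst moment_functional_bound[OF degree_monom_le])
     (simp add: if_distrib[of "\<lambda>z. z * _"] cong: if_cong)

lemma moment_functional_linear_power:
  "moment_functional a ([:d, 1:] ^ n) = (\<Sum>k\<le>n. of_nat (n choose k) * d ^ (n - k) * a k)"
proof -
  have "[:d, 1:] ^ n = (monom 1 1 + monom d 0) ^ n"
    by (simp add: monom_altdef)
  also have "\<dots> = (\<Sum>k\<le>n. monom (of_nat (n choose k) * d ^ (n - k)) k)"
    unfolding binomial_ring
  proof (rule sum.cong[OF refl])
    fix k
    have "of_nat (n choose k) = (monom (of_nat (n choose k)) 0 :: real poly)"
      by (simp add: of_nat_poly monom_0)
    then show "of_nat (n choose k) * monom 1 1 ^ k * monom d 0 ^ (n - k) =
        monom (of_nat (n choose k) * d ^ (n - k)) k"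
      by (simp only: monom_power mult_monom) simp
  qed
  finally show ?thesis by (simp add: moment_functional_sum moment_functional_monom)
qed

text \<open>For \<open>e = 0\<close> and \<open>e = 1\<close> these are the two Hankel quadratic
  forms, matching the generators in \<open>nonneg_poly_functional\<close>.\<close>

lemma moment_functional_monom_mult_square:
  "moment_functional a (monom 1 e * (q * q)) =
     (\<Sum>i<Suc (degree q). \<Sum>j<Suc (degree q). coeff q i * coeff q j * a (e + i + j))"
proof -
  let ?S = "{..<Suc (degree q)}"
  have q: "q = (\<Sum>i\<in>?S. monom (coeff q i) i)"
    by (simp only: lessThan_Suc_atMost poly_as_sum_of_monoms)
  have "monom 1 e * (q * q) = monom 1 e * ((\<Sum>i\<in>?S. monom (coeff q i) i) * (\<Sum>i\<in>?S. monom (coeff q i) i))"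
    using q by (simp only: )
  also have "\<dots> = (\<Sum>i\<in>?S. \<Sum>j\<in>?S. monom (coeff q i * coeff q j) (e + i + j))"
    by (subst sum_product) (simp only: sum_distrib_left mult_monom mult_1 add.assoc)
  finally show ?thesis by (simp only: moment_functional_sum moment_functional_monom)
qed

lemma moment_functional_nonneg:
  assumes psd: "\<And>N c. 0 \<le> (\<Sum>i<N. \<Sum>j<N. c i * c j * a (i + j))"
      "\<And>N c. 0 \<le> (\<Sum>i<N. \<Sum>j<N. c i * c j * a (Suc (i + j)))"
    and nn: "\<And>x. 0 \<le> x \<Longrightarrow> 0 \<le> poly p x"
  shows "0 \<le> moment_functional a p"
proof (rule nonneg_poly_functional[OF moment_functional_add _ _ nn])
  fix q :: "real poly"
  have "q * q = monom 1 0 * (q * q)" by (simp add: monom_0 pCons_one)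
  then show "0 \<le> moment_functional a (q * q)"
    using psd(1)[where c = "coeff q" and N = "Suc (degree q)"] moment_functional_monom_mult_square[of a 0 q]
    by (simp only: add_0)
  have "[:0, 1:] * (q * q) = monom 1 1 * (q * q)" by (simp add: monom_altdef)
  then show "0 \<le> moment_functional a ([:0, 1:] * (q * q))"
    using psd(2)[where c = "coeff q" and N = "Suc (degree q)"] moment_functional_monom_mult_square[of a 1 q]
    by (simp only: plus_1_eq_Suc add_Suc)
qed

text \<open>\<open>T \<rho>\<close> is the extended functional at the indicator of the half line
  above \<open>\<rho>\<close>. Rational endpoints keep the family countable, as stepwise extension
  requires.\<close>

lemma tail_function_exists:
  assumes psd: "\<And>N c. 0 \<le> (\<Sum>i<N. \<Sum>j<N. c i * c j * a (i + j))"
      "\<And>N c. 0 \<le> (\<Sum>i<N. \<Sum>j<N. c i * c j * a (Suc (i + j)))"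
  obtains T :: "rat \<Rightarrow> real" where
    "\<And>F p b. finite F \<Longrightarrow> (\<And>x. 0 \<le> x \<Longrightarrow> 0 \<le> poly p x + (\<Sum>\<rho>\<in>F. b \<rho> * of_bool (of_rat \<rho> < x))) \<Longrightarrow>
       0 \<le> moment_functional a p + (\<Sum>\<rho>\<in>F. b \<rho> * T \<rho>)"
proof -
  define g :: "nat \<Rightarrow> real \<Rightarrow> real" where "g i x = of_bool (of_rat (from_nat i) < x)" for i x
  have "\<exists>c. \<forall>n p b. (\<forall>x\<ge>0. 0 \<le> poly p x + (\<Sum>i<n. b i * g i x)) \<longrightarrow>
      0 \<le> moment_functional a p + (\<Sum>i<n. b i * c i)"
    by (rule riesz_extension[OF moment_functional_add moment_functional_smult])
       (auto simp: g_def intro: moment_functional_nonneg[OF psd])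
  then obtain c where c: "\<And>n p b. (\<And>x. 0 \<le> x \<Longrightarrow> 0 \<le> poly p x + (\<Sum>i<n. b i * g i x)) \<Longrightarrow>
      0 \<le> moment_functional a p + (\<Sum>i<n. b i * c i)"
    by auto
  show thesis
  proof (rule that[of "\<lambda>\<rho>. c (to_nat \<rho>)"])
    fix F :: "rat set" and p :: "real poly" and b
    assume F: "finite F" and h: "\<And>x. 0 \<le> x \<Longrightarrow> 0 \<le> poly p x + (\<Sum>\<rho>\<in>F. b \<rho> * of_bool (of_rat \<rho> < x))"
    obtain n where n: "to_nat ` F \<subseteq> {..<n}"
      using F finite_nat_bounded[of "to_nat ` F"] by auto
    define b' where "b' i = (if i \<in> to_nat ` F then b (from_nat i) else 0)" for i
    have eq: "(\<Sum>i<n. b' i * f i) = (\<Sum>\<rho>\<in>F. b \<rho> * f (to_nat \<rho>))" for f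
    proof -
      have "(\<Sum>i<n. b' i * f i) = (\<Sum>i\<in>to_nat ` F. b (from_nat i) * f i)"
        by (rule sum.mono_neutral_cong_right) (use n in \<open>auto simp: b'_def\<close>)
      also have "\<dots> = (\<Sum>\<rho>\<in>F. b \<rho> * f (to_nat \<rho>))"
        by (subst sum.reindex) auto
      finally show ?thesis .
    qed
    have "0 \<le> moment_functional a p + (\<Sum>i<n. b' i * c i)"
    proof (rule c)
      fix x :: real assume "0 \<le> x"
      from h[OF this] eq[of "\<lambda>i. g i x"] show "0 \<le> poly p x + (\<Sum>i<n. b' i * g i x)"
        by (simp only: g_def from_nat_to_nat)
    qed
    then show "0 \<le> moment_functional a p + (\<Sum>\<rho>\<in>F. b \<rho> * c (to_nat \<rho>))" unfolding eq .
  qed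
qed

text \<open>The measure is the law of the quantile function \<open>X\<close> on an interval of length \<open>a0\<close>. Since \<open>T\<close>
  need not be right continuous, the tails of \<open>X\<close> are only sandwiched between values of \<open>T\<close>.\<close>

lemma measure_with_tail_function:
  fixes T :: "rat \<Rightarrow> real"
  assumes anti: "\<And>\<rho> \<sigma>. \<rho> \<le> \<sigma> \<Longrightarrow> T \<sigma> \<le> T \<rho>" and nonneg: "\<And>\<rho>. 0 \<le> T \<rho>" and le: "\<And>\<rho>. T \<rho> \<le> a0"
    and neg: "\<And>\<rho>. \<rho> < 0 \<Longrightarrow> T \<rho> = a0" and decay: "\<And>\<rho>. 0 < \<rho> \<Longrightarrow> of_rat \<rho> * T \<rho> \<le> A"
  obtains M :: "real measure" and X :: "real \<Rightarrow> real" where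
    "finite_measure M" "X \<in> borel_measurable M" "\<And>\<omega>. \<omega> \<in> space M \<Longrightarrow> 0 \<le> X \<omega>"
    "measure M (space M) = a0"
    "\<And>\<rho>. measure M {\<omega> \<in> space M. of_rat \<rho> < X \<omega>} \<le> T \<rho>"
    "\<And>\<rho> \<sigma>. \<rho> < \<sigma> \<Longrightarrow> T \<sigma> \<le> measure M {\<omega> \<in> space M. of_rat \<rho> < X \<omega>}"
proof -
  define M :: "real measure" where "M = restrict_space lborel {0<..<a0}"
  \<comment> \<open>The generalised inverse of \<open>T\<close>; inserting 0 keeps the set nonempty
    and \<open>X\<close> nonnegative.\<close>
  define X :: "real \<Rightarrow> real" where "X \<omega> = Sup (insert 0 {of_rat \<rho> | \<rho>. \<omega> < T \<rho>})" for \<omega>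
  have sp: "space M = {0<..<a0}" by (simp add: M_def space_restrict_space)
  have setsM: "S \<in> sets M \<longleftrightarrow> S \<subseteq> {0<..<a0} \<and> S \<in> sets borel" for S
    by (simp add: M_def sets_restrict_space_iff)
  have a0: "0 \<le> a0" using nonneg[of 0] le[of 0] by simp
  have meas: "measure M {0<..<t} = t" if "0 \<le> t" "t \<le> a0" for t
    unfolding M_def using that by (subst measure_restrict_space) auto
  have "emeasure M (space M) = emeasure lborel {0<..<a0}"
    by (subst sp, unfold M_def, rule emeasure_restrict_space) auto
  then have fin: "finite_measure M" by (intro finite_measureI) (simp add: a0)
  interpret finite_measure M by (rule fin)
  \<comment> \<open>The decay of \<open>T\<close> gives \<open>\<rho> \<le> A / \<omega>\<close> for
    every positive \<open>\<rho>\<close> in the set.\<close>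
  have bdd: "bdd_above (insert 0 {of_rat \<rho> :: real | \<rho>. \<omega> < T \<rho>})" if "\<omega> \<in> space M" for \<omega>
  proof (rule bdd_aboveI[of _ "max 0 (A / \<omega>)"])
    fix z :: real assume "z \<in> insert 0 {of_rat \<rho> | \<rho>. \<omega> < T \<rho>}"
    then consider "z = 0" | \<rho> where "z = of_rat \<rho>" "\<omega> < T \<rho>" by auto
    then show "z \<le> max 0 (A / \<omega>)"
    proof cases
      case (2 \<rho>)
      have \<omega>: "0 < \<omega>" using that by (simp add: sp)
      show ?thesis
      proof (cases "0 < \<rho>")
        case True
        then have "of_rat \<rho> * \<omega> \<le> of_rat \<rho> * T \<rho>" using 2 by (intro mult_left_mono) auto
        also have "\<dots> \<le> A" using decay[OF True] .
        finally have "z \<le> A / \<omega>" using 2 \<omega> by (simp add: pos_le_divide_eq)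
        then show ?thesis by simp
      next
        case False
        then have "z \<le> 0" using 2 by simp
        then show ?thesis by simp
      qed
    qed simp
  qed
  have less_X: "t < X \<omega> \<longleftrightarrow> t < 0 \<or> (\<exists>\<rho>. t < of_rat \<rho> \<and> \<omega> < T \<rho>)" if "\<omega> \<in> space M" for t \<omega>
    unfolding X_def by (subst less_cSup_iff[OF _ bdd[OF that]]) auto
  have X_nonneg: "0 \<le> X \<omega>" if "\<omega> \<in> space M" for \<omega>
    unfolding X_def by (rule cSup_upper[OF _ bdd[OF that]]) simp
  have "X \<in> borel_measurable M"
    unfolding borel_measurable_iff_greater
  proof
    fix t
    have "{\<omega> \<in> space M. t < X \<omega>} =
        {0<..<a0} \<inter> (if t < 0 then UNIV else \<Union>\<rho>\<in>{\<rho>. t < of_rat \<rho>}. {..<T \<rho>})"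
      using less_X by (auto simp: sp)
    also have "\<dots> \<in> sets M"
      unfolding setsM by (auto intro!: sets.Int sets.countable_UN'')
    finally show "{\<omega> \<in> space M. t < X \<omega>} \<in> sets M" .
  qed
  note X_meas = this
  show thesis
  proof (rule that[OF fin X_meas X_nonneg])
    show "measure M (space M) = a0" unfolding sp using meas a0 by simp
    fix \<rho>
    have "{\<omega> \<in> space M. of_rat \<rho> < X \<omega>} \<subseteq> {0<..<T \<rho>}"
    proof
      fix \<omega> assume "\<omega> \<in> {\<omega> \<in> space M. of_rat \<rho> < X \<omega>}"
      then have \<omega>: "\<omega> \<in> space M" "of_rat \<rho> < X \<omega>" by auto
      from \<omega>(2)[unfolded less_X[OF \<omega>(1)]] consider "\<rho> < 0" | \<sigma> where "\<rho> < \<sigma>" "\<omega> < T \<sigma>"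
        by (auto simp: of_rat_less)
      then show "\<omega> \<in> {0<..<T \<rho>}"
        using \<omega>(1) neg[of \<rho>] anti by cases (force simp: sp intro: order_less_le_trans)+
    qed
    then have "measure M {\<omega> \<in> space M. of_rat \<rho> < X \<omega>} \<le> measure M {0<..<T \<rho>}"
      by (intro finite_measure_mono) (use le[of \<rho>] in \<open>auto simp: setsM\<close>)
    then show "measure M {\<omega> \<in> space M. of_rat \<rho> < X \<omega>} \<le> T \<rho>"
      using meas[OF nonneg le] by simp
    fix \<sigma> assume "\<rho> < \<sigma>"
    have "{0<..<T \<sigma>} \<subseteq> {\<omega> \<in> space M. of_rat \<rho> < X \<omega>}"
    proof
      fix \<omega> assume \<omega>: "\<omega> \<in> {0<..<T \<sigma>}"
      then have "\<omega> \<in> space M" using le[of \<sigma>] by (auto simp: sp)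
      with \<omega> \<open>\<rho> < \<sigma>\<close> show "\<omega> \<in> {\<omega> \<in> space M. of_rat \<rho> < X \<omega>}"
        using less_X[of \<omega> "of_rat \<rho>"] by (auto simp: of_rat_less)
    qed
    then have "measure M {0<..<T \<sigma>} \<le> measure M {\<omega> \<in> space M. of_rat \<rho> < X \<omega>}"
      using X_meas by (intro finite_measure_mono) measurable
    then show "T \<sigma> \<le> measure M {\<omega> \<in> space M. of_rat \<rho> < X \<omega>}"
      using meas[OF nonneg le] by simp
  qed
qed

text \<open>An approximation of \<open>x ^ n\<close> built from indicators of half lines, so that
  its integral involves only tails.\<close>

definition layer :: "nat \<Rightarrow> real \<Rightarrow> nat \<Rightarrow> real \<Rightarrow> real" where
  "layer n d K x = (\<Sum>i<K. ((real i * d + d) ^ n - (real i * d) ^ n) * of_bool (real i * d < x))"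

text \<open>The active terms form an initial segment and telescope: the value is the
  \<open>n\<close>-th power of \<open>x\<close> rounded up to a multiple of \<open>d\<close> and
  capped at \<open>K * d\<close>. The lower end contributes \<open>0 ^ n = 0\<close>, as
  \<open>n \<ge> 1\<close>.\<close>

lemma layer_bounds:
  assumes "n \<ge> 1" "0 < d" "0 \<le> x"
  shows "min x (real K * d) ^ n \<le> layer n d K x" "layer n d K x \<le> (x + d) ^ n"
proof -
  have full: "layer n d K x = (real K * d) ^ n" if "\<And>i. i < K \<Longrightarrow> real i * d < x" for K
    using that
  proof (induction K)
    case 0
    then show ?case using assms(1) by (simp add: layer_def power_0_left)
  next
    case (Suc K)
    then have "layer n d K x = (real K * d) ^ n" "real K * d < x" by auto
    then show ?case by (simp add: layer_def distrib_right add.commute)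
  qed
  have full': "layer n d (Suc K) x = (real (Suc K) * d) ^ n" if "real K * d < x" for K
  proof (rule full)
    fix i assume "i < Suc K"
    then have "real i * d \<le> real K * d" using assms(2) by (intro mult_right_mono) auto
    with that show "real i * d < x" by simp
  qed
  show "min x (real K * d) ^ n \<le> layer n d K x"
  proof (induction K)
    case 0
    then show ?case using assms by (simp add: layer_def power_0_left)
  next
    case (Suc K)
    show ?case
    proof (cases "real K * d < x")
      case True
      show ?thesis unfolding full'[OF True] using assms by (intro power_mono) auto
    next
      case False
      then have "min x (real (Suc K) * d) = min x (real K * d)"
        using assms(2) by (simp add: distrib_right)
      moreover have "layer n d (Suc K) x = layer n d K x" using False by (simp add: layer_def)
      ultimately show ?thesis using Suc by simp
    qed
  qed
  show "layer n d K x \<le> (x + d) ^ n"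
  proof (induction K)
    case 0
    then show ?case using assms by (simp add: layer_def power_0_left)
  next
    case (Suc K)
    show ?case
    proof (cases "real K * d < x")
      case True
      show ?thesis unfolding full'[OF True] using assms True by (intro power_mono) (auto simp: distrib_right)
    next
      case False
      then have "layer n d (Suc K) x = layer n d K x" by (simp add: layer_def)
      with Suc show ?thesis by simp
    qed
  qed
qed

text \<open>Pointwise comparison of powers with layer sums carries over to the extended functional,
  and the tails of \<open>X\<close> carry it over to the measure. Both inequalities for each moment
  follow as the mesh \<open>d N\<close> tends to 0.\<close>

lemma psd_imp_stieltjes_moment_seq:
  assumes psd: "\<And>N c. 0 \<le> (\<Sum>i<N. \<Sum>j<N. c i * c j * a (i + j))"
      "\<And>N c. 0 \<le> (\<Sum>i<N. \<Sum>j<N. c i * c j * a (Suc (i + j)))"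
  shows "stieltjes_moment_seq a"
proof -
  obtain T :: "rat \<Rightarrow> real" where T:
    "\<And>F p b. finite F \<Longrightarrow> (\<And>x. 0 \<le> x \<Longrightarrow> 0 \<le> poly p x + (\<Sum>\<rho>\<in>F. b \<rho> * of_bool (of_rat \<rho> < x))) \<Longrightarrow>
       0 \<le> moment_functional a p + (\<Sum>\<rho>\<in>F. b \<rho> * T \<rho>)"
    using tail_function_exists[OF psd] by metis
  let ?\<Lambda> = "moment_functional a"
  have const: "?\<Lambda> [:c:] = c * a 0" for c
    using moment_functional_monom[of a c 0] by (simp add: monom_0)
  \<comment> \<open>Each property of \<open>T\<close> comes from a pointwise inequality on the half
    line; the decay is Markov's inequality.\<close>
  have T_nonneg: "0 \<le> T \<rho>" for \<rho>
    using T[of "{\<rho>}" "[:0:]" "\<lambda>_. 1"] by (simp add: const del: pCons_0_0)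
  have T_le: "T \<rho> \<le> a 0" for \<rho>
    using T[of "{\<rho>}" "[:1:]" "\<lambda>_. -1"] by (simp add: const del: pCons_one)
  have T_neg: "T \<rho> = a 0" if "\<rho> < 0" for \<rho>
  proof -
    have "of_rat \<rho> < x" if "0 \<le> x" for x :: real
      using that \<open>\<rho> < 0\<close> by (meson of_rat_less_0_iff order_less_le_trans)
    then have "0 \<le> ?\<Lambda> [:-1:] + (\<Sum>\<sigma>\<in>{\<rho>}. 1 * T \<sigma>)"
      by (intro T) simp_all
    then have "a 0 \<le> T \<rho>" unfolding const by simp
    with T_le[of \<rho>] show ?thesis by simp
  qed
  have T_anti: "T \<sigma> \<le> T \<rho>" if "\<rho> \<le> \<sigma>" for \<rho> \<sigma>
  proof (cases "\<rho> = \<sigma>")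
    case False
    with that have less: "\<rho> < \<sigma>" by simp
    have "of_rat \<rho> < x" if "of_rat \<sigma> < x" for x :: real
      using that less by (meson of_rat_less order_less_trans)
    moreover have pair: "(\<Sum>\<tau>\<in>{\<rho>, \<sigma>}. f \<tau>) = f \<rho> + f \<sigma>" for f :: "rat \<Rightarrow> real"
      using less by simp
    ultimately have "0 \<le> ?\<Lambda> [:0:] + (\<Sum>\<tau>\<in>{\<rho>, \<sigma>}. (if \<tau> = \<rho> then 1 else -1) * T \<tau>)"
      by (intro T) (use less in \<open>auto simp only: pair, auto simp: of_bool_def\<close>)
    then show ?thesis using less unfolding const pair by simp
  qed simp
  have lin: "?\<Lambda> [:0, c:] = c * a 1" for c
    using moment_functional_monom[of a c 1] by (simp add: monom_altdef)
  have T_decay: "of_rat \<rho> * T \<rho> \<le> a 1" if "0 < \<rho>" for \<rho>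
  proof -
    have "0 \<le> ?\<Lambda> [:0, 1:] + (\<Sum>\<sigma>\<in>{\<rho>}. - of_rat \<rho> * T \<sigma>)"
      by (intro T) (use that in \<open>auto simp: of_bool_def\<close>)
    then show ?thesis unfolding lin by simp
  qed
  obtain M :: "real measure" and X :: "real \<Rightarrow> real" where M: "finite_measure M" and X [measurable]: "X \<in> borel_measurable M"
    and X_nonneg: "\<And>\<omega>. \<omega> \<in> space M \<Longrightarrow> 0 \<le> X \<omega>" and mass: "measure M (space M) = a 0"
    and upper: "\<And>\<rho>. measure M {\<omega> \<in> space M. of_rat \<rho> < X \<omega>} \<le> T \<rho>"
    and lower: "\<And>\<rho> \<sigma>. \<rho> < \<sigma> \<Longrightarrow> T \<sigma> \<le> measure M {\<omega> \<in> space M. of_rat \<rho> < X \<omega>}"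
    by (rule measure_with_tail_function[of T "a 0" "a 1", OF T_anti T_nonneg T_le T_neg T_decay])
       (assumption+, erule that, assumption+)
  interpret finite_measure M by (rule M)

  \<comment> \<open>The same mesh twice: rational for the arguments of \<open>T\<close>, real for
    the analysis.\<close>
  define \<delta> :: "nat \<Rightarrow> rat" where "\<delta> N = 1 / of_nat (Suc N)" for N
  define d :: "nat \<Rightarrow> real" where "d N = 1 / real (Suc N)" for N
  have \<delta>_pos: "0 < \<delta> N" and d_pos: "0 < d N" for N by (simp_all add: \<delta>_def d_def)
  have rat_d: "of_rat (of_nat i * \<delta> N) = real i * d N" "of_rat (of_nat i * \<delta> N - \<delta> N) = real i * d N - d N" for i N
    by (simp_all add: \<delta>_def d_def of_rat_mult of_rat_diff of_rat_divide del: of_nat_Suc)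
  have d_lim: "d \<longlonglongrightarrow> 0"
    unfolding d_def by (rule LIMSEQ_Suc[OF lim_1_over_n])

  define w where "w n N i = (real i * d N + d N) ^ n - (real i * d N) ^ n" for n N i
  have w_nonneg: "0 \<le> w n N i" for n N i
    unfolding w_def using d_pos[of N] by (simp add: power_mono)
  define S where "S n N K = (\<Sum>i<K. w n N i * T (of_nat i * \<delta> N))" for n N K

  have T_layer: "0 \<le> ?\<Lambda> p + s * S n N K"
    if "\<And>x. 0 \<le> x \<Longrightarrow> 0 \<le> poly p x + s * layer n (d N) K x" for p s n N K
  proof -
    let ?r = "\<lambda>i. of_nat i * \<delta> N"
    have inj: "inj_on ?r {..<K}" using \<delta>_pos[of N] by (auto simp: inj_on_def)
    define b where "b \<rho> = s * ((of_rat \<rho> + d N) ^ n - of_rat \<rho> ^ n)" for \<rho>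
    have "0 \<le> ?\<Lambda> p + (\<Sum>\<rho>\<in>?r ` {..<K}. b \<rho> * T \<rho>)"
    proof (rule T)
      fix x :: real assume "0 \<le> x"
      have "(\<Sum>\<rho>\<in>?r ` {..<K}. b \<rho> * of_bool (of_rat \<rho> < x)) = s * layer n (d N) K x"
        by (subst sum.reindex[OF inj]) (simp only: comp_def b_def rat_d layer_def sum_distrib_left mult.assoc)
      with that[OF \<open>0 \<le> x\<close>] show "0 \<le> poly p x + (\<Sum>\<rho>\<in>?r ` {..<K}. b \<rho> * of_bool (of_rat \<rho> < x))"
        by simp
    qed simp
    also have "(\<Sum>\<rho>\<in>?r ` {..<K}. b \<rho> * T \<rho>) = s * S n N K"
      by (subst sum.reindex[OF inj]) (simp only: comp_def b_def rat_d S_def w_def sum_distrib_left mult.assoc)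
    finally show ?thesis .
  qed

  \<comment> \<open>The upper estimate uses \<open>e = 0\<close>. The lower one uses
    \<open>e = d N\<close>, because \<open>lower\<close> compares \<open>T\<close> with a tail at a
    strictly smaller point.\<close>
  have layer_integral: "has_bochner_integral M (\<lambda>\<omega>. layer n (d N) K (X \<omega> + e))
      (\<Sum>i<K. w n N i * measure M {\<omega> \<in> space M. real i * d N - e < X \<omega>})" for n N K e
    unfolding layer_def
  proof (intro has_bochner_integral_sum)
    fix i
    let ?A = "{\<omega> \<in> space M. real i * d N - e < X \<omega>}"
    have "has_bochner_integral M (\<lambda>\<omega>. w n N i * indicator ?A \<omega>) (w n N i * measure M ?A)"
      by (intro has_bochner_integral_mult_right has_bochner_integral_real_indicator)
         (auto simp: less_top[symmetric])
    then show "has_bochner_integral M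
        (\<lambda>\<omega>. ((real i * d N + d N) ^ n - (real i * d N) ^ n) * of_bool (real i * d N < X \<omega> + e))
        (w n N i * measure M ?A)"
      by (rule has_bochner_integral_cong[THEN iffD1, rotated -1])
         (auto simp: w_def indicator_def of_bool_def)
  qed

  have trunc_int: "integrable M (\<lambda>\<omega>. min (X \<omega>) (real R) ^ n)" for R n
    by (rule integrable_const_bound[where B = "real R ^ n"])
       (use X_nonneg in \<open>auto intro!: AE_I2 power_mono simp: power_abs\<close>)

  have trunc_le: "(\<integral>\<omega>. min (X \<omega>) (real R) ^ n \<partial>M) \<le> a n" if "n \<ge> 1" for n R
  proof -
    have bound: "(\<integral>\<omega>. min (X \<omega>) (real R) ^ n \<partial>M) \<le> ?\<Lambda> ([:d N, 1:] ^ n)" for N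
    proof -
      \<comment> \<open>With this number of layers the cap \<open>?K * d N\<close> is exactly
        \<open>R\<close>.\<close>
      let ?K = "R * Suc N"
      have Kd: "real ?K * d N = real R" unfolding of_nat_mult d_def by simp
      have "(\<integral>\<omega>. min (X \<omega>) (real R) ^ n \<partial>M) \<le> (\<integral>\<omega>. layer n (d N) ?K (X \<omega> + 0) \<partial>M)"
        using layer_integral[of n N ?K 0] layer_bounds(1)[OF that d_pos X_nonneg, of _ ?K N] Kd
        by (intro integral_mono trunc_int) (auto simp: has_bochner_integral_iff)
      also have "\<dots> = (\<Sum>i<?K. w n N i * measure M {\<omega> \<in> space M. real i * d N - 0 < X \<omega>})"
        using layer_integral by (rule has_bochner_integral_integral_eq)
      also have "\<dots> \<le> S n N ?K"
        unfolding S_def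
      proof (intro sum_mono mult_left_mono w_nonneg)
        fix i show "measure M {\<omega> \<in> space M. real i * d N - 0 < X \<omega>} \<le> T (of_nat i * \<delta> N)"
          using upper[of "of_nat i * \<delta> N"] by (simp add: rat_d)
      qed
      also have "\<dots> \<le> ?\<Lambda> ([:d N, 1:] ^ n)"
        using T_layer[of "[:d N, 1:] ^ n" "-1" n N ?K] layer_bounds(2)[OF that d_pos, of _ N ?K]
        by (simp add: poly_power add.commute)
      finally show ?thesis .
    qed
    have "(\<lambda>N. ?\<Lambda> ([:d N, 1:] ^ n)) \<longlonglongrightarrow> (\<Sum>k\<le>n. of_nat (n choose k) * 0 ^ (n - k) * a k)"
      unfolding moment_functional_linear_power by (intro tendsto_intros d_lim)
    also have "(\<Sum>k\<le>n. of_nat (n choose k) * 0 ^ (n - k) * a k) = (\<Sum>k\<in>{n}. a k)"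
      by (rule sum.mono_neutral_cong_right) (auto simp: power_0_left)
    finally show ?thesis
      by (intro LIMSEQ_le_const[where X = "\<lambda>N. ?\<Lambda> ([:d N, 1:] ^ n)"]) (use bound in auto)
  qed

  have int_le: "integrable M (\<lambda>\<omega>. X \<omega> ^ n)" "(\<integral>\<omega>. X \<omega> ^ n \<partial>M) \<le> a n" if n: "n \<ge> 1" for n
  proof -
    let ?I = "\<lambda>R. \<integral>\<omega>. min (X \<omega>) (real R) ^ n \<partial>M"
    have mono: "AE \<omega> in M. mono (\<lambda>R. min (X \<omega>) (real R) ^ n)"
      using X_nonneg by (intro AE_I2) (auto simp: mono_def intro!: power_mono)
    have lim: "AE \<omega> in M. (\<lambda>R. min (X \<omega>) (real R) ^ n) \<longlonglongrightarrow> X \<omega> ^ n"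
    proof (intro AE_I2 tendsto_eventually)
      fix \<omega>
      have "\<forall>\<^sub>F R in sequentially. X \<omega> \<le> real R"
        using filterlim_real_sequentially by (auto simp: filterlim_at_top)
      then show "\<forall>\<^sub>F R in sequentially. min (X \<omega>) (real R) ^ n = X \<omega> ^ n"
        by eventually_elim simp
    qed
    have "incseq ?I"
      using X_nonneg by (intro incseq_SucI integral_mono trunc_int) (auto intro!: power_mono)
    then obtain L where L: "?I \<longlonglongrightarrow> L" using incseq_convergent[of ?I "a n"] trunc_le[OF n] by metis
    show "integrable M (\<lambda>\<omega>. X \<omega> ^ n)"
      by (rule integrable_monotone_convergence[OF trunc_int mono lim L]) simp
    have "(\<integral>\<omega>. X \<omega> ^ n \<partial>M) = L"
      by (rule integral_monotone_convergence[OF trunc_int mono lim L]) simp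
    also have "L \<le> a n" using L by (rule LIMSEQ_le_const2) (use trunc_le[OF n] in blast)
    finally show "(\<integral>\<omega>. X \<omega> ^ n \<partial>M) \<le> a n" .
  qed
  have int: "integrable M (\<lambda>\<omega>. X \<omega> ^ n)" for n
    using int_le(1)[of n] by (cases n) auto

  have int_ge: "a n \<le> (\<integral>\<omega>. X \<omega> ^ n \<partial>M)" if n: "n \<ge> 1" for n
  proof -
    have expand: "(X \<omega> + e) ^ n = (\<Sum>k\<le>n. of_nat (n choose k) * e ^ (n - k) * X \<omega> ^ k)" for \<omega> e
      unfolding binomial_ring by (simp add: mult_ac)
    have int_shift: "integrable M (\<lambda>\<omega>. (X \<omega> + e) ^ n)"
      and val_shift: "(\<integral>\<omega>. (X \<omega> + e) ^ n \<partial>M) = (\<Sum>k\<le>n. of_nat (n choose k) * e ^ (n - k) * (\<integral>\<omega>. X \<omega> ^ k \<partial>M))" for e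
      unfolding expand using int by simp_all
    \<comment> \<open>The part beyond \<open>Suc R\<close>, which the layers miss, is paid for by
      the next moment. Of the shift \<open>2 * d N\<close>, one mesh width is rounding and the other
      is the moved tail.\<close>
    have bound: "a n \<le> (\<integral>\<omega>. (X \<omega> + 2 * d N) ^ n \<partial>M) + a (Suc n) / real (Suc R)" for N R
    proof -
      let ?K = "Suc R * Suc N"
      have Kd: "real ?K * d N = real (Suc R)" unfolding of_nat_mult d_def by simp
      have "0 \<le> ?\<Lambda> (monom (1 / real (Suc R)) (Suc n) + monom (-1) n) + 1 * S n N ?K"
      proof (rule T_layer)
        fix x :: real assume x: "0 \<le> x"
        have "x ^ n \<le> x ^ Suc n / real (Suc R) + layer n (d N) ?K x"
        proof (cases "x \<le> real (Suc R)")
          case True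
          then have "x ^ n \<le> layer n (d N) ?K x"
            using layer_bounds(1)[OF n d_pos x, of ?K N] unfolding Kd by (simp only: min_absorb1)
          with x show ?thesis by (simp add: add_increasing)
        next
          case False
          then have "x ^ n * real (Suc R) \<le> x ^ n * x" using x by (intro mult_left_mono) auto
          then have "x ^ n \<le> x ^ Suc n / real (Suc R)" by (simp add: pos_le_divide_eq mult.commute)
          moreover have "0 \<le> min x (real ?K * d N) ^ n" using x unfolding Kd by simp
          then have "0 \<le> layer n (d N) ?K x"
            using layer_bounds(1)[OF n d_pos x, of ?K N] by (rule order_trans)
          ultimately show ?thesis by simp
        qed
        then show "0 \<le> poly (monom (1 / real (Suc R)) (Suc n) + monom (-1) n) x + 1 * layer n (d N) ?K x"
          by (simp add: poly_monom)
      qed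
      then have "a n \<le> S n N ?K + a (Suc n) / real (Suc R)"
        by (simp add: moment_functional_add moment_functional_monom)
      also have "S n N ?K \<le> (\<Sum>i<?K. w n N i * measure M {\<omega> \<in> space M. real i * d N - d N < X \<omega>})"
        unfolding S_def
      proof (intro sum_mono mult_left_mono w_nonneg)
        fix i show "T (of_nat i * \<delta> N) \<le> measure M {\<omega> \<in> space M. real i * d N - d N < X \<omega>}"
          using lower[of "of_nat i * \<delta> N - \<delta> N" "of_nat i * \<delta> N"] \<delta>_pos by (simp add: rat_d)
      qed
      also have "\<dots> = (\<integral>\<omega>. layer n (d N) ?K (X \<omega> + d N) \<partial>M)"
        using layer_integral by (rule has_bochner_integral_integral_eq[symmetric])
      also have "\<dots> \<le> (\<integral>\<omega>. (X \<omega> + 2 * d N) ^ n \<partial>M)"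
      proof (intro integral_mono int_shift)
        show "integrable M (\<lambda>\<omega>. layer n (d N) ?K (X \<omega> + d N))"
          using layer_integral by (auto simp: has_bochner_integral_iff)
        fix \<omega> assume "\<omega> \<in> space M"
        then have "0 \<le> X \<omega> + d N" using X_nonneg d_pos[of N] by (simp add: add_nonneg_pos less_imp_le)
        from layer_bounds(2)[OF n d_pos this, of N ?K]
        show "layer n (d N) ?K (X \<omega> + d N) \<le> (X \<omega> + 2 * d N) ^ n" by (simp add: add.assoc)
      qed
      finally show ?thesis by simp
    qed
    \<comment> \<open>The cap goes to infinity first, at fixed mesh; the mesh is refined
      afterwards.\<close>
    have bound': "a n \<le> (\<integral>\<omega>. (X \<omega> + 2 * d N) ^ n \<partial>M)" for N
    proof (rule LIMSEQ_le_const)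
      have "(\<lambda>R. (\<integral>\<omega>. (X \<omega> + 2 * d N) ^ n \<partial>M) + a (Suc n) * d R) \<longlonglongrightarrow>
          (\<integral>\<omega>. (X \<omega> + 2 * d N) ^ n \<partial>M) + a (Suc n) * 0"
        by (intro tendsto_intros d_lim)
      then show "(\<lambda>R. (\<integral>\<omega>. (X \<omega> + 2 * d N) ^ n \<partial>M) + a (Suc n) * d R) \<longlonglongrightarrow>
          (\<integral>\<omega>. (X \<omega> + 2 * d N) ^ n \<partial>M)" by simp
      show "\<exists>R0. \<forall>R\<ge>R0. a n \<le> (\<integral>\<omega>. (X \<omega> + 2 * d N) ^ n \<partial>M) + a (Suc n) * d R"
        using bound[of N] by (simp add: d_def)
    qed
    have "(\<lambda>N. \<integral>\<omega>. (X \<omega> + 2 * d N) ^ n \<partial>M) \<longlonglongrightarrow>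
        (\<Sum>k\<le>n. of_nat (n choose k) * (2 * 0) ^ (n - k) * (\<integral>\<omega>. X \<omega> ^ k \<partial>M))"
      unfolding val_shift by (intro tendsto_intros d_lim)
    also have "(\<Sum>k\<le>n. of_nat (n choose k) * (2 * 0) ^ (n - k) * (\<integral>\<omega>. X \<omega> ^ k \<partial>M)) =
        (\<Sum>k\<in>{n}. \<integral>\<omega>. X \<omega> ^ k \<partial>M)"
      by (rule sum.mono_neutral_cong_right) (auto simp: power_0_left)
    finally show ?thesis
      by (intro LIMSEQ_le_const[where X = "\<lambda>N. \<integral>\<omega>. (X \<omega> + 2 * d N) ^ n \<partial>M"]) (use bound' in auto)
  qed

  have moments: "has_bochner_integral M (\<lambda>\<omega>. X \<omega> ^ n) (a n)" for n
  proof (cases "n \<ge> 1")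
    case True
    then show ?thesis using int int_le(2)[OF True] int_ge[OF True]
      by (auto simp: has_bochner_integral_iff)
  next
    case False
    then have "n = 0" by simp
    then show ?thesis using mass by (simp add: has_bochner_integral_iff)
  qed
  \<comment> \<open>The law of \<open>X\<close> on the half line is the representing
    measure.\<close>
  let ?B = "restrict_space borel {0::real..}"
  have X': "X \<in> M \<rightarrow>\<^sub>M ?B"
    by (rule measurable_restrict_space2) (use X_nonneg in auto)
  have "has_bochner_integral (distr M ?B X) (\<lambda>x. x ^ n) (a n)" for n
    by (rule has_bochner_integral_distr[OF _ X' moments]) (simp add: measurable_restrict_space1)
  then show ?thesis
    unfolding stieltjes_moment_seq_def by (intro exI[of _ "distr M ?B X"]) simp
qed

section \<open>Convolutions of Stieltjes moment sequences\<close>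

text \<open>Integration of the pointwise inequality. Terms are indexed by \<open>I\<close> with
  exponents \<open>\<kappa> p\<close>, so that multiple sums need no collecting of powers.\<close>

lemma stieltjes_moment_seq_nonneg:
  assumes "stieltjes_moment_seq s" and nn: "\<And>u. 0 \<le> u \<Longrightarrow> 0 \<le> (\<Sum>p\<in>I. c p * u ^ \<kappa> p)"
  shows "0 \<le> (\<Sum>p\<in>I. c p * s (\<kappa> p))"
proof -
  from assms(1) obtain \<mu> :: "real measure" where \<mu>: "sets \<mu> = sets (restrict_space borel {0..})"
    and mom: "\<And>n. has_bochner_integral \<mu> (\<lambda>x. x ^ n) (s n)"
    unfolding stieltjes_moment_seq_def by blast
  have "space \<mu> = {0..}"
    using sets_eq_imp_space_eq[OF \<mu>] by (simp add: space_restrict_space)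
  then have "0 \<le> (\<integral>u. (\<Sum>p\<in>I. c p * u ^ \<kappa> p) \<partial>\<mu>)"
    by (intro Bochner_Integration.integral_nonneg nn) simp
  also have "has_bochner_integral \<mu> (\<lambda>u. \<Sum>p\<in>I. c p * u ^ \<kappa> p) (\<Sum>p\<in>I. c p * s (\<kappa> p))"
    by (intro has_bochner_integral_sum has_bochner_integral_mult_right mom)
  then have "(\<integral>u. (\<Sum>p\<in>I. c p * u ^ \<kappa> p) \<partial>\<mu>) = (\<Sum>p\<in>I. c p * s (\<kappa> p))"
    by (rule has_bochner_integral_integral_eq)
  finally show ?thesis .
qed

lemma stieltjes_SR_convolution:
  fixes x :: "nat \<Rightarrow> real"
  assumes "m \<ge> 1" and x: "\<And>i. i \<le> m \<Longrightarrow> 0 \<le> x i" and y: "0 \<le> y"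
    and s: "stieltjes_moment_seq s" and t: "stieltjes_moment_seq t"
  shows "stieltjes_moment_seq (\<lambda>n. \<Sum>k=0..n. SR_triangle m (SR_alpha m x y) n k * s k * t (n - k))"
proof -
  define S where "S = SR_triangle m (SR_alpha m x y)"
  define z where "z n = (\<Sum>k\<le>n. S n k * s k * t (n - k))" for n
  have psd: "0 \<le> (\<Sum>i<N. \<Sum>j<N. c i * c j * z (i + e + j))" for N c e
  proof -
    \<comment> \<open>The triple sum is flattened to expose the quadratic form as a polynomial in
      \<open>u\<close> and \<open>v\<close>.\<close>
    define I where "I = (SIGMA i:{..<N}. SIGMA j:{..<N}. {..i + e + j})"
    define C where "C = (\<lambda>(i, j, k). c i * c j * S (i + e + j) k)"
    define \<kappa> :: "nat \<times> nat \<times> nat \<Rightarrow> nat" where "\<kappa> = (\<lambda>(i, j, k). k)"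
    define \<kappa>' where "\<kappa>' = (\<lambda>(i, j, k). i + e + j - k)"
    have flat: "(\<Sum>i<N. \<Sum>j<N. c i * c j * (\<Sum>k\<le>i + e + j. S (i + e + j) k * f k * g (i + e + j - k))) =
        (\<Sum>p\<in>I. C p * f (\<kappa> p) * g (\<kappa>' p))" for f g :: "nat \<Rightarrow> real"
      unfolding I_def C_def \<kappa>_def \<kappa>'_def
      by (simp add: sum.Sigma sum_distrib_left case_prod_unfold mult.assoc)
    have "0 \<le> (\<Sum>p\<in>I. C p * u ^ \<kappa> p * v ^ \<kappa>' p)" if uv: "0 \<le> u" "0 \<le> v" for u v
    proof -
      let ?P = "conj_production_op m (\<lambda>i. v * x i) (v * y) u"
      have "real_cone.net ?P"
        by (rule real_cone.net_conj_production_op) (use uv x y in auto)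
      from hankel_psd[OF this, where N = N and c = c and e = e] show ?thesis
        unfolding flat[of "\<lambda>k. u ^ k" "\<lambda>k. v ^ k", symmetric] S_def SR_homogeneous_row[OF assms(1)] .
    qed
    \<comment> \<open>First \<open>u\<close> is integrated out against a measure for
      \<open>s\<close> at fixed \<open>v\<close>, then \<open>v\<close> against one for
      \<open>t\<close>.\<close>
    then have "0 \<le> (\<Sum>p\<in>I. (C p * v ^ \<kappa>' p) * s (\<kappa> p))" if "0 \<le> v" for v
      using that by (intro stieltjes_moment_seq_nonneg[OF s]) (simp add: mult_ac)
    then have "0 \<le> (\<Sum>p\<in>I. (C p * s (\<kappa> p)) * t (\<kappa>' p))"
      by (intro stieltjes_moment_seq_nonneg[OF t]) (simp add: mult_ac)
    then show ?thesis unfolding z_def flat .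
  qed
  have "stieltjes_moment_seq z"
  proof (rule psd_imp_stieltjes_moment_seq)
    show "0 \<le> (\<Sum>i<N. \<Sum>j<N. c i * c j * z (i + j))" for N c using psd[of c 0 N] by simp
    show "0 \<le> (\<Sum>i<N. \<Sum>j<N. c i * c j * z (Suc (i + j)))" for N c using psd[of c 1 N] by simp
  qed
  then show ?thesis unfolding z_def[abs_def] S_def by (simp only: atLeast0AtMost)
qed

theorem theorem1p13:
  fixes m :: nat
  assumes "m \<ge> 1"
  shows
    "(let \<alpha> = SR_alpha m (\<lambda>i. indet (X i)) (indet Y) :: nat \<Rightarrow> var mpoly
      in mpoly_log_convex 3 (\<lambda>n. SR_row_poly m \<alpha> n (indet Q)) \<and>
         mpoly_log_convex 3 (\<lambda>n. SR_rev_row_poly m \<alpha> n (indet Q)))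
     \<and>
     (\<forall>(x :: nat \<Rightarrow> real) (y :: real) (s :: nat \<Rightarrow> real) (t :: nat \<Rightarrow> real).
        (\<forall>i\<le>m. 0 \<le> x i) \<and> 0 \<le> y \<and> stieltjes_moment_seq s \<and> stieltjes_moment_seq t \<longrightarrow>
        stieltjes_moment_seq
          (\<lambda>n. \<Sum>k=0..n. SR_triangle m (SR_alpha m x y) n k * s k * t (n - k)))"
proof -
  interpret pos_cone "{p :: var mpoly. nonneg_coeffs p}" by (rule nonneg_coeffs_cone)
  let ?\<alpha> = "SR_alpha m (\<lambda>i. indet (X i)) (indet Y) :: nat \<Rightarrow> var mpoly"
  \<comment> \<open>The constant 1 serves as \<open>v\<close> for the row polynomials and as
    \<open>u\<close> for the reversed ones.\<close>
  have one: "nonneg_coeffs (1 :: var mpoly)" using one_in by simp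
  have "mpoly_log_convex 3 (\<lambda>n. SR_row_poly m ?\<alpha> n (indet Q))"
    using log_convex_SR_rows[OF assms nonneg_coeffs_indet nonneg_coeffs_indet nonneg_coeffs_indet one, of X Y Q]
    by (simp add: SR_row_poly_def)
  moreover have "mpoly_log_convex 3 (\<lambda>n. SR_rev_row_poly m ?\<alpha> n (indet Q))"
    using log_convex_SR_rows[OF assms nonneg_coeffs_indet nonneg_coeffs_indet one nonneg_coeffs_indet, of X Y Q]
    by (simp add: SR_rev_row_poly_def)
  ultimately show ?thesis
    using stieltjes_SR_convolution[OF assms] by (simp add: Let_def)
qed

end
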